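(* Given any parameter $\ell>1$ and positive integer $n$, there exist a $\frac1n$-separated subset $\{\xi_j\}_{j=1}^{m_n}$ of $\Omega$ with respect to the metric $\rho_\Omega$ and a sequence of polynomials $\{P_j\}_{j=1}^{m_n}\subset\Pi_{c_0n}^{d+1}$ such that for every $\xi\in\Omega$, $$\sum_{j=1}^{m_n}P_j(\xi)=1\quad\text{and}\quad|P_j(\xi)|\le C_1\big(1+n\rho_\Omega(\xi,\xi_j)\big)^{-\ell},\quad j=1,2,\dots,m_n,$$ where the constants $c_0$ and $C_1$ depend only on $d$ and $\ell$.
   Context: Let $d\ge1$ be an integer, $\|\cdot\|$ the Euclidean norm, $\mathrm{dist}(\xi,E)=\inf_{\eta\in E}\|\xi-\eta\|$. A bounded domain $\Omega_0\subset\mathbb{R}^{d+1}$ is $C^2$ if there exist $\delta>0$, $M>0$ and a finite cover of its boundary $\Gamma$ by connected open sets $U_1,\dots,U_J$ such that (i) for every $x\in\Omega_0$ with $\mathrm{dist}(x,\Gamma)<\delta$ there is $j$ with $x\in U_j$ and $\mathrm{dist}(x,\partial U_j)>\delta$; (ii) for each $j$ there is a Cartesian coordinate system $(\xi_{j,1},\dots,\xi_{j,d+1})$ in $U_j$ in which $\Omega_0\cap U_j$ is represented by $\xi_{j,d+1}\le f_j(\xi_{j,1},\dots,\xi_{j,d})$ with $f_j:\mathbb{R}^d\to\mathbb{R}$ of class $C^2$ and $\max_{i,k}\|\partial_i\partial_kf_j\|_\infty\le M$. $\Omega$ is the closure of an open, connected, bounded $C^2$-domain in $\mathbb{R}^{d+1}$,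 with boundary $\Gamma=\partial\Omega$. The metric on $\Omega$ is $\rho_\Omega(\xi,\eta)=\|\xi-\eta\|+\big|\sqrt{\mathrm{dist}(\xi,\Gamma)}-\sqrt{\mathrm{dist}(\eta,\Gamma)}\big|$. A set $\Lambda$ in a metric space $(X,\rho)$ is $\varepsilon$-separated, for some $\varepsilon>0$, if $\rho(\omega,\omega')\ge\varepsilon$ for any two distinct $\omega,\omega'\in\Lambda$. $\Pi_s^{d+1}$ is the space of real polynomials on $\mathbb{R}^{d+1}$ of total degree at most $s$.
   Formalization: The constant C_1 may depend on Ω as well as on d and ℓ (uniformity over all Ω fails, e.g. for long tubes with n=1); c_0 depends only on d and ℓ; the chart condition for the open domain Ω_0 uses a strict inequality, since with ≤ no open domain would qualify. *)

theory Defs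
  imports "HOL-Analysis.Analysis"
begin

(* R^(d+1), split as R^d x R with d = CARD('d) >= 1, so that graphs over the first d
   coordinates can be written directly.  The product norm is sqrt (|u|^2 + t^2), i.e. the
   Euclidean norm. *)
type_synonym 'd space = "(real ^ 'd) \<times> real"

definition has_partial_derivative ::
  "(real ^ 'd \<Rightarrow> real) \<Rightarrow> 'd::finite \<Rightarrow> (real ^ 'd \<Rightarrow> real) \<Rightarrow> bool" where
  "has_partial_derivative f i f' \<longleftrightarrow>
     (\<forall>x. ((\<lambda>t. f (x + t *\<^sub>R axis i 1)) has_real_derivative f' x) (at 0))"

(* f is of class C^2 on R^d, and all its second-order partial derivatives are bounded by M. *)
definition C2_bounded :: "real \<Rightarrow> (real ^ 'd::finite \<Rightarrow> real) \<Rightarrow> bool" where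
  "C2_bounded M f \<longleftrightarrow>
     (\<exists>g h. \<forall>i. has_partial_derivative f i (g i) \<and> continuous_on UNIV (g i) \<and>
        (\<forall>k. has_partial_derivative (g i) k (h i k) \<and> continuous_on UNIV (h i k) \<and>
             (\<forall>x. \<bar>h i k x\<bar> \<le> M)))"

(* T x is the vector of coordinates of x with respect to some origin and orthonormal frame. *)
definition cartesian_coordinates :: "('d::finite space \<Rightarrow> 'd space) \<Rightarrow> bool" where
  "cartesian_coordinates T \<longleftrightarrow>
     (\<exists>Q a. orthogonal_transformation Q \<and> T = (\<lambda>x. Q (x - a)))"

(* The inequality in the last clause is strict because D is open: with a non-strict one,
   D \<inter> U j would be open and closed in the connected set U j, and no domain would qualify.
   The non-strict inequality describes closure D inside U j. *)
definition C2_domain :: "'d::finite space set \<Rightarrow> bool" where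
  "C2_domain D \<longleftrightarrow>
     open D \<and> connected D \<and> bounded D \<and> D \<noteq> {} \<and>
     (\<exists>\<delta>>0. \<exists>M>0. \<exists>(J::nat) U.
        (\<forall>j\<in>{1..J}. open (U j) \<and> connected (U j)) \<and>
        frontier D \<subseteq> (\<Union>j\<in>{1..J}. U j) \<and>
        (\<forall>x\<in>D. infdist x (frontier D) < \<delta> \<longrightarrow>
           (\<exists>j\<in>{1..J}. x \<in> U j \<and> infdist x (frontier (U j)) > \<delta>)) \<and>
        (\<forall>j\<in>{1..J}. \<exists>T f. cartesian_coordinates T \<and> C2_bounded M f \<and>
           D \<inter> U j = {x \<in> U j. snd (T x) < f (fst (T x))}))"

definition rho :: "'a::euclidean_space set \<Rightarrow> 'a \<Rightarrow> 'a \<Rightarrow> real" where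
  "rho \<Omega> \<xi> \<eta> = norm (\<xi> - \<eta>) +
     \<bar>sqrt (infdist \<xi> (frontier \<Omega>)) - sqrt (infdist \<eta> (frontier \<Omega>))\<bar>"

definition separated :: "('a \<Rightarrow> 'a \<Rightarrow> real) \<Rightarrow> real \<Rightarrow> 'a set \<Rightarrow> bool" where
  "separated r \<epsilon> \<Lambda> \<longleftrightarrow> (\<forall>x\<in>\<Lambda>. \<forall>y\<in>\<Lambda>. x \<noteq> y \<longrightarrow> r x y \<ge> \<epsilon>)"

(* Real polynomial functions of total degree at most s; \<alpha> ranges over the multi-indices
   of order at most s, indexed by the standard basis. *)
definition poly_space :: "nat \<Rightarrow> ('a::euclidean_space \<Rightarrow> real) set" where
  "poly_space s = {P. \<exists>c. P = (\<lambda>x.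
     \<Sum>\<alpha>\<in>{\<alpha> \<in> Basis \<rightarrow>\<^sub>E {..s}. sum \<alpha> Basis \<le> s}. c \<alpha> * (\<Prod>b\<in>Basis. (x \<bullet> b) ^ \<alpha> b))}"

end

theory Submission
  imports Defs "HOL-Computational_Algebra.Polynomial"
begin

text \<open>
The metric \<open>rho\<close> measures the Euclidean distance together with the difference of the square roots of
the distances to the boundary.  A univariate polynomial of degree \<open>n\<close> in a variable \<open>s\<close> that ranges
over an interval \<open>[0, R\<^sup>2]\<close> can resolve the scale \<open>1 / n\<close> in \<open>sqrt s\<close>; this is the metric of the disc
or the ball near the boundary, and it explains why \<open>rho\<close> is the right one.

The partition is built from univariate partitions of unity that sum to \<open>1\<close> exactly because they
telescope (\<open>poly_partition_of_unity_1d\<close>): they are differences of polynomial approximations to Heaviside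
functions (\<open>poly_approx_heaviside\<close>), obtained by integrating powers of a Dirichlet kernel.  Their product over
the coordinates localizes in the Euclidean distance.  Each member of this product is split further, by a
univariate partition of unity in a quadratic polynomial \<open>\<phi>\<close> that depends on the member and approximates the
distance to the boundary near its centre \<open>t\<close>, up to an error \<open>O(\<bar>x - t\<bar>\<^sup>2)\<close>
(\<open>quadratic_chart_exists\<close>).  The error of \<open>sqrt \<phi>\<close> is then \<open>O(\<bar>x - t\<bar>)\<close>, which the first localization
already controls, so the products are localized in \<open>rho\<close>.  Since all partitions involved are exact, no
normalization and no patching between boundary charts is necessary.  Grouping the products by the points of a
maximal separated set of centres gives the claim (\<open>localized_partition_exists\<close>).

The \<open>C\<^sup>2\<close> condition enters only through touching balls of a fixed radius on both sides of the boundary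
(\<open>C2_domain_two_sided_ball\<close>); their distance functions bound the distance to the boundary from both sides
and yield \<open>\<phi>\<close>.  As the constant in the decay may depend on the domain, a factor in the degree can be
traded for it (\<open>localized_partition_degree_at_most\<close>).
\<close>

section \<open>Polynomial functions of bounded total degree\<close>

text \<open>The multi-indices of order at most \<open>s\<close>: the index set of the sum that defines the
polynomial space.\<close>

abbreviation (input) multi_indices :: "nat \<Rightarrow> ('a::euclidean_space \<Rightarrow> nat) set" where
  "multi_indices s \<equiv> {\<alpha> \<in> Basis \<rightarrow>\<^sub>E {..s}. sum \<alpha> Basis \<le> s}"

lemma finite_multi_indices: "finite (multi_indices s :: ('a::euclidean_space \<Rightarrow> nat) set)"
  by (rule finite_subset[of _ "Basis \<rightarrow>\<^sub>E {..s}"]) (auto intro: finite_PiE)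

lemma poly_space_add:
  assumes "P \<in> poly_space s" "Q \<in> poly_space s"
  shows "(\<lambda>x. P x + Q x) \<in> poly_space s"
proof -
  obtain c d where
    "P = (\<lambda>x. \<Sum>\<alpha>\<in>multi_indices s. c \<alpha> * (\<Prod>b\<in>Basis. (x \<bullet> b) ^ \<alpha> b))"
    "Q = (\<lambda>x. \<Sum>\<alpha>\<in>multi_indices s. d \<alpha> * (\<Prod>b\<in>Basis. (x \<bullet> b) ^ \<alpha> b))"
    using assms unfolding poly_space_def by blast
  then have "(\<lambda>x. P x + Q x) =
      (\<lambda>x. \<Sum>\<alpha>\<in>multi_indices s. (c \<alpha> + d \<alpha>) * (\<Prod>b\<in>Basis. (x \<bullet> b) ^ \<alpha> b))"
    by (simp add: sum.distrib distrib_right)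
  then show ?thesis
    unfolding poly_space_def by (intro CollectI exI[of _ "\<lambda>\<alpha>. c \<alpha> + d \<alpha>"])
qed

lemma poly_space_cmult:
  assumes "P \<in> poly_space s"
  shows "(\<lambda>x. a * P x) \<in> poly_space s"
proof -
  obtain c where
    "P = (\<lambda>x. \<Sum>\<alpha>\<in>multi_indices s. c \<alpha> * (\<Prod>b\<in>Basis. (x \<bullet> b) ^ \<alpha> b))"
    using assms unfolding poly_space_def by blast
  then have "(\<lambda>x. a * P x) =
      (\<lambda>x. \<Sum>\<alpha>\<in>multi_indices s. (a * c \<alpha>) * (\<Prod>b\<in>Basis. (x \<bullet> b) ^ \<alpha> b))"
    by (simp add: sum_distrib_left mult.assoc)
  then show ?thesis
    unfolding poly_space_def by (intro CollectI exI[of _ "\<lambda>\<alpha>. a * c \<alpha>"])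
qed

lemma poly_space_zero: "(\<lambda>x. 0) \<in> poly_space s"
  unfolding poly_space_def by (intro CollectI exI[of _ "\<lambda>_. 0"]) simp

lemma poly_space_sum:
  assumes "\<And>i. i \<in> I \<Longrightarrow> P i \<in> poly_space s"
  shows "(\<lambda>x. \<Sum>i\<in>I. P i x) \<in> poly_space s"
  using assms
  by (induction I rule: infinite_finite_induct)
    (auto intro: poly_space_zero poly_space_add)

lemma poly_space_monomial:
  fixes \<alpha> :: "'a::euclidean_space \<Rightarrow> nat"
  assumes "sum \<alpha> Basis \<le> s"
  shows "(\<lambda>x::'a. \<Prod>b\<in>Basis. (x \<bullet> b) ^ \<alpha> b) \<in> poly_space s"
proof -
  let ?\<beta> = "restrict \<alpha> Basis"
  have "\<alpha> b \<le> s" if "b \<in> Basis" for b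
    using assms member_le_sum[of b Basis \<alpha>] that by auto
  then have mem: "?\<beta> \<in> multi_indices s"
    using assms by (auto simp: restrict_def)
  have delta: "(\<Sum>\<gamma>\<in>A. (if \<gamma> = \<beta> then 1 else 0) * f \<gamma>) = f \<beta>"
    if "finite A" "\<beta> \<in> A" for A and \<beta> :: "'a \<Rightarrow> nat" and f :: "_ \<Rightarrow> real"
    using that by (simp add: if_distrib[where f = "\<lambda>c. c * _"] cong: if_cong)
  have "(\<lambda>x::'a. \<Prod>b\<in>Basis. (x \<bullet> b) ^ \<alpha> b) =
      (\<lambda>x. \<Sum>\<gamma>\<in>multi_indices s. (if \<gamma> = ?\<beta> then 1 else 0) * (\<Prod>b\<in>Basis. (x \<bullet> b) ^ \<gamma> b))"
    by (subst delta[OF finite_multi_indices mem]) simp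
  then show ?thesis
    unfolding poly_space_def by (intro CollectI exI[of _ "\<lambda>\<gamma>. if \<gamma> = ?\<beta> then 1 else 0"])
qed

lemma poly_space_mult:
  fixes P Q :: "'a::euclidean_space \<Rightarrow> real"
  assumes "P \<in> poly_space s" "Q \<in> poly_space t"
  shows "(\<lambda>x. P x * Q x) \<in> poly_space (s + t)"
proof -
  obtain c d where
    P: "P = (\<lambda>x. \<Sum>\<alpha>\<in>multi_indices s. c \<alpha> * (\<Prod>b\<in>Basis. (x \<bullet> b) ^ \<alpha> b))" and
    Q: "Q = (\<lambda>x. \<Sum>\<beta>\<in>multi_indices t. d \<beta> * (\<Prod>b\<in>Basis. (x \<bullet> b) ^ \<beta> b))"
    using assms unfolding poly_space_def by blast
  have "(\<lambda>x. P x * Q x) = (\<lambda>x. \<Sum>\<alpha>\<in>multi_indices s. \<Sum>\<beta>\<in>multi_indices t.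
      (c \<alpha> * d \<beta>) * (\<Prod>b\<in>Basis. (x \<bullet> b) ^ (\<alpha> b + \<beta> b)))"
    unfolding P Q by (simp add: sum_product power_add prod.distrib mult_ac)
  moreover have "\<dots> \<in> poly_space (s + t)"
    by (intro poly_space_sum poly_space_cmult poly_space_monomial)
      (auto simp: sum.distrib intro: add_mono)
  ultimately show ?thesis by simp
qed

lemma poly_space_mono:
  fixes P :: "'a::euclidean_space \<Rightarrow> real"
  assumes "P \<in> poly_space s" "s \<le> t"
  shows "P \<in> poly_space t"
proof -
  obtain c where
    P: "P = (\<lambda>x. \<Sum>\<alpha>\<in>multi_indices s. c \<alpha> * (\<Prod>b\<in>Basis. (x \<bullet> b) ^ \<alpha> b))"
    using assms unfolding poly_space_def by blast
  show ?thesis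
    unfolding P using assms(2)
    by (intro poly_space_sum poly_space_cmult poly_space_monomial) auto
qed

lemma poly_space_const: "(\<lambda>x::'a::euclidean_space. a) \<in> poly_space s"
proof -
  have "(\<lambda>x::'a. a * (\<Prod>b\<in>Basis. (x \<bullet> b) ^ 0)) \<in> poly_space s"
    by (intro poly_space_cmult poly_space_monomial) simp
  then show ?thesis by simp
qed

lemma poly_space_inner:
  fixes v :: "'a::euclidean_space"
  assumes "s \<ge> 1"
  shows "(\<lambda>x. x \<bullet> v) \<in> poly_space s"
proof -
  have *: "(\<lambda>x::'a. x \<bullet> b) \<in> poly_space s" if "b \<in> Basis" for b
  proof -
    have "(\<Prod>b'\<in>Basis. (x \<bullet> b') ^ (if b' = b then 1 else 0)) = x \<bullet> b" for x :: 'a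
      using that by (simp add: if_distrib[where f = "\<lambda>k. _ ^ k"] prod.delta cong: if_cong)
    moreover have "(\<lambda>x::'a. \<Prod>b'\<in>Basis. (x \<bullet> b') ^ (if b' = b then 1 else 0)) \<in> poly_space s"
      using assms that by (intro poly_space_monomial) simp
    ultimately show ?thesis by simp
  qed
  have "(\<lambda>x. x \<bullet> v) = (\<lambda>x. \<Sum>b\<in>Basis. (v \<bullet> b) * (x \<bullet> b))"
    by (subst euclidean_inner) (simp add: mult.commute)
  then show ?thesis
    using * by (auto intro!: poly_space_sum poly_space_cmult)
qed

lemma poly_space_power:
  assumes "P \<in> poly_space s"
  shows "(\<lambda>x. P x ^ k) \<in> poly_space (k * s)"
  by (induction k) (auto intro: poly_space_const poly_space_mult[OF assms])

lemma poly_space_prod: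
  assumes "finite I" "\<And>i. i \<in> I \<Longrightarrow> P i \<in> poly_space s"
  shows "(\<lambda>x. \<Prod>i\<in>I. P i x) \<in> poly_space (card I * s)"
  using assms
  by (induction I rule: finite_induct)
    (auto intro: poly_space_const poly_space_mult)

lemma poly_space_compose:
  assumes "P \<in> poly_space s" "degree p \<le> k"
  shows "(\<lambda>x. poly p (P x)) \<in> poly_space (k * s)"
proof -
  have "(\<lambda>x. poly p (P x)) = (\<lambda>x. \<Sum>i\<le>degree p. coeff p i * P x ^ i)"
    by (simp add: poly_altdef)
  moreover have "\<dots> \<in> poly_space (k * s)"
    using assms
    by (intro poly_space_sum poly_space_cmult poly_space_mono[OF poly_space_power])
      (auto intro: mult_le_mono1)
  ultimately show ?thesis by simp
qed

lemma poly_space_continuous: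
  assumes "P \<in> poly_space s"
  shows "continuous_on A P"
  using assms unfolding poly_space_def by (auto intro!: continuous_intros)

section \<open>Univariate polynomials close to a Heaviside function\<close>

text \<open>The quotient of \<open>sin ((2 k + 1) \<theta>)\<close> by \<open>sin \<theta>\<close> is a polynomial in \<open>sin \<theta>\<close>.  As a function
of \<open>u = sin \<theta>\<close> it has size about \<open>2 k + 1\<close> near \<open>0\<close> and is at most \<open>1 / \<bar>u\<bar>\<close> in absolute value; its powers are the localized kernels used below.\<close>

lemma poly_dirichlet_kernel:
  "\<exists>q::real poly. degree q \<le> 2 * k \<and> (\<forall>\<theta>. poly q (sin \<theta>) * sin \<theta> = sin (real (2 * k + 1) * \<theta>))"
proof -
  let ?P = "\<lambda>k. \<exists>q::real poly. degree q \<le> 2 * k \<and>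
      (\<forall>\<theta>. poly q (sin \<theta>) * sin \<theta> = sin (real (2 * k + 1) * \<theta>))"
  \<comment> \<open>The recursion for three consecutive values of \<open>k\<close> calls for a two-step induction.\<close>
  have "?P k \<and> ?P (Suc k)"
  proof (induction k)
    case 0
    have "poly [:3, 0, -4:] (sin \<theta>) * sin \<theta> = sin (real (2 * 1 + 1) * \<theta>)" for \<theta> :: real
    proof -
      have "sin (real (2 * 1 + 1) * \<theta>) = sin (2 * \<theta> + \<theta>)"
        by (rule arg_cong[where f = sin]) simp
      also have "\<dots> = 2 * sin \<theta> * (cos \<theta>)\<^sup>2 + (1 - 2 * (sin \<theta>)\<^sup>2) * sin \<theta>"
        by (simp only: sin_add sin_double cos_double_sin power2_eq_square mult.assoc)
      also have "\<dots> = poly [:3, 0, -4:] (sin \<theta>) * sin \<theta>"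
        unfolding cos_squared_eq by (simp add: algebra_simps power2_eq_square)
      finally show ?thesis by simp
    qed
    then have "?P (Suc 0)"
      by (intro exI[of _ "[:3, 0, -4:]"]) simp
    moreover have "?P 0"
      by (intro exI[of _ 1]) simp
    ultimately show ?case by simp
  next
    case (Suc k)
    then obtain q0 q1 :: "real poly" where
      d: "degree q0 \<le> 2 * k" "degree q1 \<le> 2 * Suc k" and
      q0: "\<And>\<theta>. poly q0 (sin \<theta>) * sin \<theta> = sin (real (2 * k + 1) * \<theta>)" and
      q1: "\<And>\<theta>. poly q1 (sin \<theta>) * sin \<theta> = sin (real (2 * Suc k + 1) * \<theta>)"
      by blast
    let ?q = "[:2, 0, -4:] * q1 - q0"
    have "degree ([:2, 0, -4:] * q1) \<le> 2 * Suc (Suc k)"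
      using degree_mult_le[of "[:2, 0, -4:]" q1] d by simp
    then have "degree ?q \<le> 2 * Suc (Suc k)"
      using d by (intro degree_diff_le) auto
    moreover have "poly ?q (sin \<theta>) * sin \<theta> = sin (real (2 * Suc (Suc k) + 1) * \<theta>)" for \<theta>
    proof -
      let ?m = "real (2 * Suc k + 1) * \<theta>"
      have "poly ?q (sin \<theta>) * sin \<theta> = 2 * (1 - 2 * (sin \<theta>)\<^sup>2) * sin ?m - sin (real (2 * k + 1) * \<theta>)"
        unfolding q0[of \<theta>, symmetric] q1[of \<theta>, symmetric] by (simp add: algebra_simps power2_eq_square)
      also have "1 - 2 * (sin \<theta>)\<^sup>2 = cos (2 * \<theta>)"
        by (simp add: cos_double_sin)
      also have "real (2 * k + 1) * \<theta> = ?m - 2 * \<theta>"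
        by (simp add: algebra_simps)
      also have "2 * cos (2 * \<theta>) * sin ?m - sin (?m - 2 * \<theta>) = sin (?m + 2 * \<theta>)"
        by (simp add: sin_add sin_diff)
      finally show ?thesis
        by (simp add: algebra_simps)
    qed
    ultimately have "?P (Suc (Suc k))" by blast
    with Suc show ?case by blast
  qed
  then show ?thesis by blast
qed

lemma poly_antiderivative:
  fixes p :: "real poly"
  shows "\<exists>q. degree q \<le> degree p + 1 \<and> poly q 0 = 0 \<and> (\<forall>x. (poly q has_real_derivative poly p x) (at x))"
proof -
  let ?q = "\<Sum>i\<le>degree p. monom (coeff p i / real (Suc i)) (Suc i)"
  have "degree ?q \<le> degree p + 1"
    by (rule degree_sum_le) (auto intro: order.trans[OF degree_monom_le])
  moreover have "poly ?q 0 = 0"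
    by (simp add: poly_sum poly_monom)
  moreover have "(poly ?q has_real_derivative poly p x) (at x)" for x
  proof -
    have "poly ?q = (\<lambda>x. \<Sum>i\<le>degree p. coeff p i / real (Suc i) * x ^ Suc i)"
      by (simp add: fun_eq_iff poly_sum poly_monom del: power_Suc)
    moreover have "((\<lambda>x. \<Sum>i\<le>degree p. coeff p i / real (Suc i) * x ^ Suc i)
        has_real_derivative (\<Sum>i\<le>degree p. coeff p i * x ^ i)) (at x)"
    proof (rule DERIV_sum)
      fix i
      show "((\<lambda>x. coeff p i / real (Suc i) * x ^ Suc i) has_real_derivative coeff p i * x ^ i) (at x)"
        using DERIV_cmult[OF DERIV_pow[of "Suc i" x], of "coeff p i / real (Suc i)"]
        by (simp del: power_Suc of_nat_Suc)
    qed
    ultimately show ?thesis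
      by (simp add: poly_altdef del: power_Suc of_nat_Suc)
  qed
  ultimately show ?thesis by blast
qed

lemma poly_even_part:
  fixes p :: "real poly"
  shows "\<exists>q. degree q \<le> degree p \<and> (\<forall>v. poly q (v\<^sup>2) = poly p v + poly p (- v))"
proof -
  \<comment> \<open>The odd part is carried along, since multiplication by the variable exchanges the two parts.\<close>
  have "\<exists>q r. degree q \<le> degree p \<and> degree r \<le> degree p \<and>
     (\<forall>v. poly q (v\<^sup>2) = poly p v + poly p (- v)) \<and> (\<forall>v. v * poly r (v\<^sup>2) = poly p v - poly p (- v))"
  proof (induction p)
    case 0
    show ?case by (intro exI[of _ 0]) simp
  next
    case (pCons a p)
    show ?case
    proof (cases "p = 0")
      case True
      then show ?thesis
        by (intro exI[of _ "[:2 * a:]"] exI[of _ 0]) simp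
    next
      case False
      from pCons obtain q r where d: "degree q \<le> degree p" "degree r \<le> degree p" and
        qr: "\<And>v. poly q (v\<^sup>2) = poly p v + poly p (- v)" "\<And>v. v * poly r (v\<^sup>2) = poly p v - poly p (- v)"
        by blast
      have "degree (pCons (2 * a) r) \<le> degree (pCons a p)"
        using d False by (auto simp: degree_pCons_eq_if)
      moreover have "degree q \<le> degree (pCons a p)"
        using d by (auto simp: degree_pCons_eq_if)
      moreover have "poly (pCons (2 * a) r) (v\<^sup>2) = poly (pCons a p) v + poly (pCons a p) (- v)" for v
      proof -
        have "poly p v = poly p (- v) + v * poly r (v\<^sup>2)"
          using qr(2)[of v] by simp
        then show ?thesis
          by (simp add: power2_eq_square algebra_simps)
      qed
      moreover have "v * poly q (v\<^sup>2) = poly (pCons a p) v - poly (pCons a p) (- v)" for v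
        using qr(1)[of v] by (simp add: algebra_simps)
      ultimately show ?thesis by blast
    qed
  qed
  then show ?thesis by blast
qed

lemma sin_ge_half:
  assumes "0 \<le> x" "x \<le> (1::real)"
  shows "x / 2 \<le> sin x"
proof (cases "x = 0")
  case False
  then obtain z where z: "0 < z" "z < x" "sin x - sin 0 = (x - 0) * cos z"
    using MVT2[of 0 x sin cos] assms by (auto intro: DERIV_sin)
  have "cos (pi / 3) \<le> cos z"
    using z assms pi_gt3 by (intro cos_monotone_0_pi_le) auto
  then have "x * (1 / 2) \<le> x * cos z"
    using assms by (intro mult_left_mono) (auto simp: cos_60)
  then show ?thesis
    using z by simp
qed simp

text \<open>A polynomial of degree \<open>O(n)\<close> that approximates the Heaviside function on \<open>[-1, 1]\<close>, with an error
that decays at the scale \<open>1 / n\<close> to any prescribed order \<open>p\<close>.  It is the normalized primitive of the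
power \<open>2 p\<close> of the kernel \<open>q u = sin (m arcsin u) / u\<close>, where \<open>m = 2 n + 1\<close>.  The total mass of this
power is at least of order \<open>m ^ (2 p - 1)\<close>, because \<open>q \<ge> m / 2\<close> near \<open>0\<close>, and its mass beyond \<open>v > 0\<close>
is at most \<open>v ^ (1 - 2 p)\<close>, because \<open>\<bar>q u\<bar> \<le> 1 / \<bar>u\<bar>\<close>.\<close>

lemma poly_approx_heaviside:
  assumes "p \<ge> 1" "n \<ge> 1"
  shows "\<exists>h::real poly. degree h \<le> (8 * p) * n \<and>
     (\<forall>u\<in>{-1..1}. \<bar>poly h u - (if u \<ge> 0 then 1 else 0)\<bar> \<le> 8 ^ p / (1 + real n * \<bar>u\<bar>) ^ p)"
proof -
  define m where "m = real (2 * n + 1)"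
  have m: "m \<ge> 3" "m > real n" using assms by (auto simp: m_def)
  obtain q :: "real poly" where dq: "degree q \<le> 2 * n" and
    q: "\<And>\<theta>. poly q (sin \<theta>) * sin \<theta> = sin (m * \<theta>)"
    using poly_dirichlet_kernel[of n] unfolding m_def by blast
  obtain F where dF: "degree F \<le> degree (q ^ (2 * p)) + 1" and F0: "poly F 0 = 0" and
    dF_dx: "\<And>x. (poly F has_real_derivative poly q x ^ (2 * p)) (at x)"
    using poly_antiderivative[of "q ^ (2 * p)"] by (auto simp: poly_power)
  have q_arcsin: "poly q u * u = sin (m * arcsin u)" if "\<bar>u\<bar> \<le> 1" for u
    using q[of "arcsin u"] that by (simp add: abs_le_iff)
  have q_even: "poly q (- u) = poly q u" if "\<bar>u\<bar> \<le> 1" for u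
  proof (cases "u = 0")
    case False
    have "poly q (- u) * (- u) = - (poly q u * u)"
      using q_arcsin[of u] q_arcsin[of "- u"] that by (simp add: arcsin_minus abs_le_iff)
    then show ?thesis using False by simp
  qed simp
  have mono: "poly F u \<le> poly F v" if "u \<le> v" for u v
    using dF_dx that by (intro DERIV_nonneg_imp_nondecreasing[of u v "poly F"]) (auto intro!: exI)
  have odd: "poly F (- v) = - poly F v" if "0 \<le> v" "v \<le> 1" for v
  proof (cases "v = 0")
    case False
    have "((\<lambda>x. poly F x + poly F (- x)) has_real_derivative 0) (at x)" if "0 < x" "x < v" for x
    proof -
      have "((\<lambda>x. poly F (- x)) has_real_derivative poly q (- x) ^ (2 * p) * (- 1)) (at x)"
        by (rule DERIV_chain2[OF dF_dx]) (auto intro!: derivative_eq_intros)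
      moreover have "poly q (- x) = poly q x"
        using that \<open>v \<le> 1\<close> by (intro q_even) auto
      ultimately show ?thesis
        using DERIV_add[OF dF_dx[of x]] by fastforce
    qed
    then have "poly F v + poly F (- v) = poly F 0 + poly F (- 0)"
      using False that by (intro DERIV_isconst_end[of 0 v "\<lambda>x. poly F x + poly F (- x)"])
        (auto intro!: continuous_intros)
    then show ?thesis using F0 by simp
  qed (simp add: F0)
  have tail: "poly F 1 - poly F v \<le> inverse v ^ (2 * p - 1)" if v: "0 < v" "v \<le> 1" for v
  proof -
    define e where "e = 2 * p - 1"
    have e: "2 * p = Suc e" "e \<ge> 1" using assms by (auto simp: e_def)
    \<comment> \<open>The kernel power is at most \<open>inverse x ^ (e + 1)\<close>, so the sum of \<open>F\<close> and \<open>inverse x ^ e\<close> decreases.\<close>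
    have "poly F 1 + inverse 1 ^ e \<le> poly F v + inverse v ^ e"
    proof (rule DERIV_nonpos_imp_nonincreasing[OF v(2)])
      fix x :: real
      assume x: "v \<le> x" "x \<le> 1"
      then have "x > 0" using v by simp
      have "\<bar>poly q x * x\<bar> \<le> 1"
        using q_arcsin[of x] x v by simp
      then have "\<bar>poly q x\<bar> \<le> inverse x"
        using \<open>x > 0\<close> by (simp add: abs_mult field_simps)
      then have "\<bar>poly q x\<bar> ^ (2 * p) \<le> inverse x ^ (2 * p)"
        by (intro power_mono) auto
      then have le: "poly q x ^ (2 * p) \<le> inverse x ^ Suc e"
        unfolding e(1)[symmetric] by (subst (asm) power_even_abs) simp_all
      have "((\<lambda>x. poly F x + inverse x ^ e) has_real_derivative
          poly q x ^ (2 * p) + real e * inverse x ^ (e - 1) * (- (inverse x * inverse x))) (at x)"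
        using \<open>x > 0\<close> DERIV_power[OF DERIV_inverse[of x], of e]
        by (intro DERIV_add dF_dx) (simp add: power2_eq_square mult_ac)
      moreover have "poly q x ^ (2 * p) + real e * inverse x ^ (e - 1) * (- (inverse x * inverse x)) \<le> 0"
      proof -
        define A where "A = inverse x ^ Suc e"
        have "real e * inverse x ^ (e - 1) * (- (inverse x * inverse x)) = - (real e * A)"
          using e by (cases e) (auto simp: A_def)
        moreover have "1 * A \<le> real e * A"
          using e \<open>x > 0\<close> by (intro mult_right_mono) (auto simp: A_def)
        ultimately show ?thesis
          using le unfolding A_def[symmetric] by linarith
      qed
      ultimately show "\<exists>y. ((\<lambda>x. poly F x + inverse x ^ e) has_real_derivative y) (at x) \<and> y \<le> 0"
        by blast
    qed
    then show ?thesis by (simp add: e_def)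
  qed
  have bulk: "(m / 2) ^ (2 * p) / (2 * m) \<le> poly F 1"
  proof -
    \<comment> \<open>On \<open>(0, s)\<close> the argument \<open>m * arcsin x\<close> stays below \<open>1\<close>, where the sine is at least half its argument.\<close>
    define s where "s = sin (1 / m)"
    have s: "1 / (2 * m) \<le> s" "s \<le> 1"
      using sin_ge_half[of "1 / m"] m by (auto simp: s_def)
    have "s > 0" using s m by (smt (verit) divide_pos_pos)
    have lower: "m / 2 \<le> poly q x" if x: "0 < x" "x < s" for x
    proof -
      have a: "0 < arcsin x" "arcsin x < arcsin s"
        using x s arcsin_less_arcsin[of 0 x] arcsin_less_arcsin[of x s] by auto
      have "1 / m \<le> 1" using m by simp
      then have "1 / m \<le> pi / 2" using pi_gt3 by linarith
      then have "arcsin s = 1 / m"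
        using m unfolding s_def by (intro arcsin_sin) (auto intro: order.trans[of _ 0])
      then have "m * arcsin x \<le> 1"
        using mult_left_mono[of "arcsin x" "arcsin s" m] a m by simp
      then have "m * arcsin x / 2 \<le> sin (m * arcsin x)"
        using a m by (intro sin_ge_half) auto
      moreover have "x \<le> arcsin x"
        using sin_x_le_x[of "arcsin x"] a x s by simp
      then have "m * x / 2 \<le> m * arcsin x / 2"
        using m by simp
      ultimately have "m / 2 * x \<le> poly q x * x"
        using q_arcsin[of x] x s by simp
      then show ?thesis using x by simp
    qed
    have "\<exists>z. 0 < z \<and> z < s \<and> poly F s - poly F 0 = (s - 0) * poly q z ^ (2 * p)"
      using \<open>s > 0\<close> dF_dx by (rule MVT2)
    then obtain z where z: "0 < z" "z < s" "poly F s - poly F 0 = (s - 0) * poly q z ^ (2 * p)"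
      by blast
    have "(m / 2) ^ (2 * p) / (2 * m) = 1 / (2 * m) * (m / 2) ^ (2 * p)" by simp
    also have "\<dots> \<le> s * poly q z ^ (2 * p)"
      using s lower[OF z(1,2)] m \<open>s > 0\<close> by (intro mult_mono power_mono) auto
    also have "\<dots> = poly F s" using z F0 by simp
    also have "\<dots> \<le> poly F 1" using s by (intro mono)
    finally show ?thesis .
  qed
  have F1: "poly F 1 > 0"
    using m by (intro less_le_trans[OF _ bulk]) auto
  define h where "h = [:1 / 2:] + smult (1 / (2 * poly F 1)) F"
  have h: "poly h u = 1 / 2 + poly F u / (2 * poly F 1)" for u
    by (simp add: h_def)
  \<comment> \<open>Both the error at \<open>v \<ge> 0\<close> and, since \<open>F\<close> is odd, the error at \<open>- v\<close> equal this quotient.\<close>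
  have decay: "0 \<le> (poly F 1 - poly F v) / (2 * poly F 1) \<and>
      (poly F 1 - poly F v) / (2 * poly F 1) \<le> 8 ^ p / (1 + real n * v) ^ p" if v: "0 \<le> v" "v \<le> 1" for v
  proof (intro conjI)
    show "0 \<le> (poly F 1 - poly F v) / (2 * poly F 1)"
      using mono[OF v(2)] F1 by simp
    have "(poly F 1 - poly F v) / (2 * poly F 1) \<le> 8 ^ p / (1 + m * v) ^ p"
    proof (cases "m * v \<le> 1")
      case True
      have "(poly F 1 - poly F v) / (2 * poly F 1) \<le> 1"
        using mono[OF v(1)] F1 F0 by simp
      moreover have "(1 + m * v) ^ p \<le> 8 ^ p"
        using True v m by (intro power_mono) auto
      moreover have "(1 + m * v) ^ p > 0"
        using v m by (intro zero_less_power add_pos_nonneg) auto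
      ultimately show ?thesis by (smt (verit) le_divide_eq_1_pos)
    next
      case False
      then have "v > 0" using v by (cases "v = 0") auto
      have "(poly F 1 - poly F v) / (2 * poly F 1) \<le> inverse v ^ (2 * p - 1) / (2 * ((m / 2) ^ (2 * p) / (2 * m)))"
        using tail[OF \<open>v > 0\<close> v(2)] bulk F1 m \<open>v > 0\<close> by (intro frac_le) auto
      also have "\<dots> = 4 ^ p / (m * v) ^ (2 * p - 1)"
      proof -
        have "m ^ (2 * p) = m * m ^ (2 * p - 1)"
          using assms by (simp flip: power_Suc)
        then show ?thesis
          using \<open>v > 0\<close> m power_mult[of "2::real" 2 p]
          by (simp add: field_simps power_mult_distrib power_divide)
      qed
      also have "\<dots> \<le> 4 ^ p / (m * v) ^ p"
        using False assms m \<open>v > 0\<close>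
        by (intro divide_left_mono power_increasing mult_pos_pos zero_less_power) auto
      also have "\<dots> = 8 ^ p / (2 * (m * v)) ^ p"
      proof -
        have "(8::real) ^ p = 2 ^ p * 4 ^ p" by (simp flip: power_mult_distrib)
        then show ?thesis by (simp add: power_mult_distrib)
      qed
      also have "\<dots> \<le> 8 ^ p / (1 + m * v) ^ p"
        using False \<open>v > 0\<close> m
        by (intro divide_left_mono power_mono mult_pos_pos zero_less_power) (auto intro: add_pos_pos)
      finally show ?thesis .
    qed
    also have "\<dots> \<le> 8 ^ p / (1 + real n * v) ^ p"
      using v m by (intro divide_left_mono power_mono mult_pos_pos zero_less_power add_left_mono mult_right_mono)
        (auto intro: add_pos_nonneg)
    finally show "(poly F 1 - poly F v) / (2 * poly F 1) \<le> 8 ^ p / (1 + real n * v) ^ p" .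
  qed
  have "\<bar>poly h u - (if u \<ge> 0 then 1 else 0)\<bar> \<le> 8 ^ p / (1 + real n * \<bar>u\<bar>) ^ p" if u: "u \<in> {-1..1}" for u
  proof (cases "u \<ge> 0")
    case True
    define y where "y = (poly F 1 - poly F u) / (2 * poly F 1)"
    have "poly h u - 1 = - y"
      using F1 by (simp add: h y_def field_simps)
    moreover have "0 \<le> y \<and> y \<le> 8 ^ p / (1 + real n * u) ^ p"
      using decay[of u] True u by (simp add: y_def)
    ultimately show ?thesis
      using True by simp
  next
    case False
    define y where "y = (poly F 1 - poly F (- u)) / (2 * poly F 1)"
    have "poly h u = y"
      using F1 odd[of "- u"] False u by (simp add: h y_def field_simps)
    moreover have "0 \<le> y \<and> y \<le> 8 ^ p / (1 + real n * (- u)) ^ p"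
      using decay[of "- u"] False u unfolding y_def by simp
    ultimately show ?thesis
      using False by simp
  qed
  moreover have "degree h \<le> (8 * p) * n"
  proof -
    have "degree (q ^ (2 * p)) \<le> 2 * n * (2 * p)"
      using degree_power_le[of q "2 * p"] dq by (meson le_trans mult_le_mono1)
    moreover have "1 \<le> n * p" using assms by simp
    moreover have "2 * n * (2 * p) = 4 * (n * p)" by simp
    ultimately have "degree F \<le> 8 * (n * p)"
      using dF by linarith
    then have "degree F \<le> 8 * p * n"
      by (simp add: mult_ac)
    then show ?thesis
      unfolding h_def using degree_smult_le[of "1 / (2 * poly F 1)" F]
      by (intro degree_add_le) auto
  qed
  ultimately show ?thesis by blast
qed

section \<open>Univariate localized partitions of unity\<close>

text \<open>The bound is uniform in \<open>y\<close> and \<open>N\<close>: each term is dominated by an increment of the bounded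
function \<open>t / (1 + \<bar>t\<bar>)\<close>, so that the sum telescopes.\<close>

lemma sum_inverse_square_le:
  fixes y :: real
  shows "(\<Sum>j\<le>N. 1 / (1 + \<bar>y - real j\<bar>) ^ 2) \<le> 4"
proof -
  define \<psi> where "\<psi> t = t / (1 + \<bar>t\<bar>)" for t :: real
  have step: "1 / (1 + \<bar>t\<bar>) ^ 2 \<le> 2 * (\<psi> (t + 1) - \<psi> t)" for t :: real
  proof -
    consider "t \<ge> 0" | "t \<le> -1" | "-1 < t" "t < 0" by linarith
    then show ?thesis
    proof cases
      case 1
      have "1 / (1 + t) ^ 2 = 2 / (2 * (1 + t) ^ 2)" by simp
      also have "\<dots> \<le> 2 / ((1 + t) * (2 + t))"
        using 1 by (intro divide_left_mono mult_pos_pos zero_less_power) (auto simp: power2_eq_square algebra_simps)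
      also have "\<dots> = 2 * (\<psi> (t + 1) - \<psi> t)"
        using 1 by (simp add: \<psi>_def field_simps)
      finally show ?thesis using 1 by simp
    next
      case 2
      define r where "r = - t"
      have "t = - r" "r \<ge> 1" using 2 by (auto simp: r_def)
      moreover have "1 / (1 + r) ^ 2 \<le> 2 * (r / (1 + r) - (r - 1) / r)"
      proof -
        have "r / (1 + r) - (r - 1) / r = 1 / (r * (1 + r))"
          using \<open>r \<ge> 1\<close> by (simp add: field_simps)
        also have "\<dots> \<ge> 1 / (1 + r) ^ 2"
          using \<open>r \<ge> 1\<close> by (intro divide_left_mono) (auto simp: power2_eq_square)
        finally have "1 / (1 + r) ^ 2 \<le> r / (1 + r) - (r - 1) / r" .
        then have "1 * (1 / (1 + r) ^ 2) \<le> 2 * (r / (1 + r) - (r - 1) / r)"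
          by (intro mult_mono) auto
        then show ?thesis by simp
      qed
      ultimately show ?thesis
        unfolding \<psi>_def by (simp add: diff_divide_distrib)
    next
      case 3
      define a where "a = - t"
      have a: "0 < a" "a < 1" "t = - a" using 3 by (auto simp: a_def)
      have "1 / (1 + a) ^ 2 \<le> 1"
        using a by (simp add: divide_le_eq_1 one_le_power)
      also have "1 = 2 * ((1 - a) / 2 + a / 2)" by (simp add: field_simps)
      also have "\<dots> \<le> 2 * ((1 - a) / (2 - a) + a / (1 + a))"
        using a by (intro mult_left_mono add_mono divide_left_mono) auto
      also have "\<dots> = 2 * (\<psi> (t + 1) - \<psi> t)"
        using a by (simp add: \<psi>_def)
      finally show ?thesis using a by simp
    qed
  qed
  have bound: "\<bar>\<psi> t\<bar> \<le> 1" for t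
    by (simp add: \<psi>_def abs_divide)
  have "(\<Sum>j\<le>N. 1 / (1 + \<bar>y - real j\<bar>) ^ 2) \<le> (\<Sum>j\<le>N. 2 * (\<psi> (real (Suc j) - y) - \<psi> (real j - y)))"
  proof (rule sum_mono)
    fix j
    show "1 / (1 + \<bar>y - real j\<bar>) ^ 2 \<le> 2 * (\<psi> (real (Suc j) - y) - \<psi> (real j - y))"
      using step[of "real j - y"] by (simp add: abs_minus_commute algebra_simps)
  qed
  also have "\<dots> = 2 * (\<psi> (real (Suc N) - y) - \<psi> (- y))"
    by (induction N) (auto simp: algebra_simps)
  also have "\<dots> \<le> 4"
    using bound[of "real (Suc N) - y"] bound[of "- y"] by (simp add: abs_le_iff)
  finally show ?thesis .
qed

lemma inverse_power_shift_le:
  fixes a b c :: real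
  assumes "0 < b" "0 \<le> a" "a \<le> c * b" "0 < a" "0 \<le> c"
  shows "1 / b ^ p \<le> c ^ p / a ^ p"
proof -
  have "a ^ p \<le> c ^ p * b ^ p"
    using assms by (simp add: power_mono flip: power_mult_distrib)
  then show ?thesis
    using assms by (simp add: field_simps)
qed

text \<open>A polynomial partition of unity in one variable \<open>s = v\<^sup>2\<close>, localized at the nodes \<open>v = k / n\<close> of
\<open>[0, R]\<close>.  With \<open>E k\<close> an approximate indicator of \<open>v \<ge> k / n\<close>, \<open>E 0 = 1\<close> and \<open>E (R n + 1) = 0\<close>, the
differences \<open>E k - E (k + 1)\<close> telescope to exactly \<open>1\<close>.  Each \<open>E k\<close> is the sum of an approximate
Heaviside function at \<open>v\<close> and at \<open>- v\<close>, which makes it even in \<open>v\<close>, hence a polynomial in \<open>s\<close>; the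
summand at \<open>- v\<close> is small, since \<open>- v\<close> lies further from the node, on its left.
The same family serves for an affine coordinate \<open>v\<close> and for the root \<open>v\<close> of a nonnegative polynomial.\<close>

lemma poly_partition_of_unity_1d:
  assumes p: "p \<ge> 1" and R: "R \<ge> (1::nat)"
  shows "\<exists>C K. C > 0 \<and> (\<forall>n\<ge>1. \<exists>q :: nat \<Rightarrow> real poly.
     (\<forall>k. degree (q k) \<le> K * n) \<and> (\<forall>s. (\<Sum>k\<le>R * n. poly (q k) s) = 1) \<and>
     (\<forall>k\<le>R * n. \<forall>v\<in>{0..real R}. \<bar>poly (q k) (v\<^sup>2)\<bar> \<le> C / (1 + \<bar>real n * v - real k\<bar>) ^ p))"
proof -
  \<comment> \<open>The factor that brings \<open>v - k / n\<close> and \<open>- v - k / n\<close> into \<open>[-1, 1]\<close>.\<close>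
  define S where "S = 2 * real R"
  have S: "S \<ge> 1" "S > 0" using R by (auto simp: S_def)
  define B where "B = 2 * (8 * S) ^ p"
  have B: "B > 0" using S by (simp add: B_def)
  have "\<exists>q :: nat \<Rightarrow> real poly.
     (\<forall>k. degree (q k) \<le> 8 * p * n) \<and> (\<forall>s. (\<Sum>k\<le>R * n. poly (q k) s) = 1) \<and>
     (\<forall>k\<le>R * n. \<forall>v\<in>{0..real R}.
        \<bar>poly (q k) (v\<^sup>2)\<bar> \<le> (B + B * 2 ^ p + 2 ^ p) / (1 + \<bar>real n * v - real k\<bar>) ^ p)"
    if n: "n \<ge> 1" for n
  proof -
    obtain h :: "real poly" where dh: "degree h \<le> 8 * p * n" and
      h: "\<And>u. \<bar>u\<bar> \<le> 1 \<Longrightarrow> \<bar>poly h u - (if u \<ge> 0 then 1 else 0)\<bar> \<le> 8 ^ p / (1 + real n * \<bar>u\<bar>) ^ p"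
      using poly_approx_heaviside[OF p n] by (auto simp: abs_le_iff)
    define g where "g k = pcompose h [:- real k / (real n * S), 1 / S:]" for k
    have g: "poly (g k) v = poly h ((v - real k / real n) / S)" for k v
      using S n by (simp add: g_def poly_pcompose field_simps)
    have dg: "degree (g k) \<le> 8 * p * n" for k
      using dh S by (simp add: g_def degree_pcompose)
    obtain e where e: "\<And>k. degree (e k) \<le> degree (g k)"
      "\<And>k v. poly (e k) (v\<^sup>2) = poly (g k) v + poly (g k) (- v)"
      using poly_even_part[of "g _"] by metis
    define E where "E k = (if k = 0 then 1 else if k \<le> R * n then e k else 0)" for k
    have dE: "degree (E k) \<le> 8 * p * n" for k
      using e(1)[of k] dg[of k] by (auto simp: E_def)
    have E: "\<bar>poly (E k) (v\<^sup>2) - (if real k \<le> real n * v then 1 else 0)\<bar> \<le> B / (1 + \<bar>real n * v - real k\<bar>) ^ p"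
      if v: "0 \<le> v" "v \<le> real R" for k v
    proof -
      have nv: "real n * v \<le> real (R * n)"
        using v n by (simp add: mult.commute mult_left_mono)
      consider "k = 0" | "k > R * n" | "1 \<le> k" "k \<le> R * n" by linarith
      then show ?thesis
      proof cases
        case 1
        then show ?thesis using v B by (simp add: E_def)
      next
        case 2
        then have "real n * v < real k" "k \<noteq> 0"
          using nv by linarith+
        then show ?thesis using 2 B by (simp add: E_def)
      next
        case 3
        have kn: "real k / real n \<le> real R" "0 < real k / real n"
          using 3 n by (simp_all add: field_simps flip: of_nat_mult)
        define u where "u = (v - real k / real n) / S"
        define w where "w = (- v - real k / real n) / S"
        have u: "\<bar>u\<bar> \<le> 1" "\<bar>w\<bar> \<le> 1" "w < 0"
          using v kn S(2) unfolding u_def w_def abs_divide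
          by (simp_all add: S_def divide_less_0_iff abs_le_iff)
        have uw: "\<bar>u\<bar> \<le> \<bar>w\<bar>"
          using v S kn(2) unfolding u_def w_def abs_divide by (intro divide_right_mono) linarith+
        have nu: "real n * \<bar>u\<bar> = \<bar>real n * v - real k\<bar> / S"
        proof -
          have "real n * \<bar>u\<bar> = \<bar>real n * u\<bar>" by (simp add: abs_mult)
          also have "real n * u = (real n * v - real k) / S"
            using n by (simp add: u_def right_diff_distrib)
          finally show ?thesis using S by simp
        qed
        have sgn_u: "u \<ge> 0 \<longleftrightarrow> real k \<le> real n * v"
          using n S by (simp add: u_def field_simps)
        have scale: "8 ^ p / (1 + real n * \<bar>u\<bar>) ^ p \<le> (8 * S) ^ p / (1 + \<bar>real n * v - real k\<bar>) ^ p"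
        proof -
          have "1 / (1 + real n * \<bar>u\<bar>) ^ p \<le> S ^ p / (1 + \<bar>real n * v - real k\<bar>) ^ p"
            unfolding nu using S
            by (intro inverse_power_shift_le) (auto simp: distrib_left intro: add_pos_nonneg)
          then have "8 ^ p * (1 / (1 + real n * \<bar>u\<bar>) ^ p) \<le> 8 ^ p * (S ^ p / (1 + \<bar>real n * v - real k\<bar>) ^ p)"
            by (intro mult_left_mono) auto
          then show ?thesis
            by (simp add: power_mult_distrib)
        qed
        have "8 ^ p / (1 + real n * \<bar>w\<bar>) ^ p \<le> 8 ^ p / (1 + real n * \<bar>u\<bar>) ^ p"
          using uw by (intro divide_left_mono power_mono mult_pos_pos zero_less_power add_left_mono mult_left_mono)
            (auto intro: add_pos_nonneg)
        then have "\<bar>poly (g k) (- v)\<bar> \<le> (8 * S) ^ p / (1 + \<bar>real n * v - real k\<bar>) ^ p"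
          using h[OF u(2)] u(3) scale by (simp add: g flip: w_def)
        moreover have "\<bar>poly (g k) v - (if real k \<le> real n * v then 1 else 0)\<bar>
            \<le> (8 * S) ^ p / (1 + \<bar>real n * v - real k\<bar>) ^ p"
          using h[OF u(1)] scale unfolding sgn_u by (simp add: g flip: u_def)
        moreover have "poly (E k) (v\<^sup>2) = poly (g k) v + poly (g k) (- v)"
          using 3 e(2)[of k v] by (simp add: E_def)
        ultimately show ?thesis
          unfolding B_def by (simp add: abs_le_iff)
      qed
    qed
    define q where "q k = E k - E (Suc k)" for k
    have "degree (q k) \<le> 8 * p * n" for k
      using dE unfolding q_def by (intro degree_diff_le)
    moreover have "(\<Sum>k\<le>R * n. poly (q k) s) = 1" for s
    proof -
      have "(\<Sum>k\<le>R * n. poly (q k) s) = poly (E 0) s - poly (E (Suc (R * n))) s"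
        unfolding q_def poly_diff by (rule sum_telescope)
      then show ?thesis by (simp add: E_def)
    qed
    moreover have "\<bar>poly (q k) (v\<^sup>2)\<bar> \<le> (B + B * 2 ^ p + 2 ^ p) / (1 + \<bar>real n * v - real k\<bar>) ^ p"
      if v: "v \<in> {0..real R}" for k v
    proof -
      define a where "a = 1 + \<bar>real n * v - real k\<bar>"
      have a: "a > 0" by (simp add: a_def add_pos_nonneg)
      define c where "c j = (if real j \<le> real n * v then 1 else 0 :: real)" for j
      have "\<bar>poly (E k) (v\<^sup>2) - c k\<bar> \<le> B / a ^ p"
        using E[of v k] v by (simp add: c_def a_def)
      moreover have "\<bar>poly (E (Suc k)) (v\<^sup>2) - c (Suc k)\<bar> \<le> B * 2 ^ p / a ^ p"
      proof -
        have "a \<le> 2 * (1 + \<bar>real n * v - real (Suc k)\<bar>)"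
          unfolding a_def by (simp add: algebra_simps abs_if)
        then have "1 / (1 + \<bar>real n * v - real (Suc k)\<bar>) ^ p \<le> 2 ^ p / a ^ p"
          using a by (intro inverse_power_shift_le) (auto simp: a_def)
        then have "B / (1 + \<bar>real n * v - real (Suc k)\<bar>) ^ p \<le> B * 2 ^ p / a ^ p"
          using mult_left_mono[of _ _ B] B by fastforce
        then show ?thesis
          using E[of v "Suc k"] v by (simp add: c_def)
      qed
      moreover have "\<bar>c k - c (Suc k)\<bar> \<le> 2 ^ p / a ^ p"
      proof (cases "real k \<le> real n * v \<and> real n * v < real (Suc k)")
        case True
        then have "1 / 1 ^ p \<le> 2 ^ p / a ^ p"
          using a by (intro inverse_power_shift_le) (auto simp: a_def)
        then show ?thesis using True by (simp add: c_def)
      next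
        case False
        then have "c k = c (Suc k)" by (auto simp: c_def)
        then show ?thesis using a by simp
      qed
      moreover have "poly (q k) (v\<^sup>2) = poly (E k) (v\<^sup>2) - poly (E (Suc k)) (v\<^sup>2)"
        by (simp add: q_def)
      ultimately have "\<bar>poly (q k) (v\<^sup>2)\<bar> \<le> B / a ^ p + B * 2 ^ p / a ^ p + 2 ^ p / a ^ p"
        by linarith
      then show ?thesis by (simp add: add_divide_distrib a_def)
    qed
    ultimately show ?thesis by blast
  qed
  moreover have "B + B * 2 ^ p + 2 ^ p > 0" using B by (simp add: add_pos_pos)
  ultimately show ?thesis by blast
qed

section \<open>Two-sided touching balls of smooth domains\<close>

text \<open>A first-order expansion along a path that changes one coordinate at a time: it needs partial
derivatives only, and no Frechet differentiability.  The numbers \<open>c i\<close> approximate the partial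
derivatives within distance \<open>\<bar>v\<bar>\<close> of \<open>u\<close>, with error at most \<open>B\<close>; the choice \<open>c = 0\<close> gives a Lipschitz bound.\<close>

lemma has_partial_derivative_increment:
  fixes F :: "real ^ 'd::finite \<Rightarrow> real" and v :: "real ^ 'd"
  assumes F: "\<And>i. has_partial_derivative F i (G i)"
    and G: "\<And>i w. norm w \<le> norm v \<Longrightarrow> \<bar>G i (u + w) - c i\<bar> \<le> B"
  shows "\<bar>F (u + v) - F u - (\<Sum>i\<in>UNIV. c i * v $ i)\<bar> \<le> real CARD('d) * B * norm v"
proof -
  \<comment> \<open>The part of \<open>v\<close> with coordinates in \<open>S\<close>, together with the fraction \<open>t\<close> of coordinate \<open>j\<close>.\<close>
  define cut where "cut S t j = (\<chi> i. if i \<in> S then v $ i else if i = j then t * v $ i else 0)"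
    for S :: "'d set" and t :: real and j :: 'd
  have norm_cut: "norm (cut S t j) \<le> norm v" if "0 \<le> t" "t \<le> 1" for S t j
    using that by (intro norm_le_componentwise_cart) (auto simp: cut_def abs_mult mult_left_le_one_le)
  have "\<bar>F (u + cut S 0 j) - F u - (\<Sum>i\<in>S. c i * v $ i)\<bar> \<le> real (card S) * B * norm v"
    if "finite S" for S j
    using that
  proof (induction S rule: finite_induct)
    case empty
    have "cut {} 0 j = 0" by (simp add: cut_def vec_eq_iff)
    then show ?case by simp
  next
    case (insert k S)
    let ?\<gamma> = "\<lambda>t. F (u + cut S t k)"
    have deriv: "(?\<gamma> has_real_derivative G k (u + cut S t k) * v $ k) (at t)" for t
    proof -
      have "((\<lambda>s. F ((u + cut S t k) + s *\<^sub>R axis k 1)) has_real_derivative G k (u + cut S t k)) (at 0)"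
        using F[of k] unfolding has_partial_derivative_def by blast
      then have "((\<lambda>s. F ((u + cut S t k) + ((s - t) * v $ k) *\<^sub>R axis k 1)) has_real_derivative
          G k (u + cut S t k) * v $ k) (at t)"
        by (intro DERIV_chain2[where f = "\<lambda>s. F ((u + cut S t k) + s *\<^sub>R axis k 1)"
              and g = "\<lambda>s. (s - t) * v $ k"])
          (auto intro!: derivative_eq_intros)
      moreover have "(u + cut S t k) + ((s - t) * v $ k) *\<^sub>R axis k 1 = u + cut S s k" for s
        using insert by (auto simp: cut_def vec_eq_iff axis_def algebra_simps)
      ultimately show ?thesis by simp
    qed
    obtain z where z: "0 < z" "z < 1" "?\<gamma> 1 - ?\<gamma> 0 = (1 - 0) * (G k (u + cut S z k) * v $ k)"
      using MVT2[of 0 1 ?\<gamma>] deriv by force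
    have ends: "cut S 1 k = cut (insert k S) 0 j" "cut S 0 k = cut S 0 j"
      by (auto simp: cut_def vec_eq_iff)
    have "\<bar>G k (u + cut S z k) - c k\<bar> * \<bar>v $ k\<bar> \<le> B * norm v"
      using z norm_cut[of z S k] G[of "cut S z k" k] component_le_norm_cart[of v k]
      by (intro mult_mono) (auto intro: order.trans[OF abs_ge_zero])
    moreover have "\<bar>G k (u + cut S z k) - c k\<bar> * \<bar>v $ k\<bar> = \<bar>?\<gamma> 1 - ?\<gamma> 0 - c k * v $ k\<bar>"
      using z by (simp add: left_diff_distrib flip: abs_mult)
    ultimately have "\<bar>F (u + cut (insert k S) 0 j) - F (u + cut S 0 j) - c k * v $ k\<bar> \<le> B * norm v"
      unfolding ends by simp
    moreover have "\<bar>F (u + cut S 0 j) - F u - (\<Sum>i\<in>S. c i * v $ i)\<bar> \<le> real (card S) * B * norm v"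
      using insert by simp
    moreover have "real (card (insert k S)) * B * norm v = B * norm v + real (card S) * B * norm v"
      using insert by (simp add: algebra_simps)
    moreover have "(\<Sum>i\<in>insert k S. c i * v $ i) = c k * v $ k + (\<Sum>i\<in>S. c i * v $ i)"
      using insert by simp
    ultimately show ?case by linarith
  qed
  from this[OF finite[of UNIV]] show ?thesis
    by (simp add: cut_def)
qed

lemma C2_bounded_taylor:
  fixes f :: "real ^ 'd::finite \<Rightarrow> real"
  assumes "C2_bounded M f"
  shows "\<exists>g. \<forall>v. \<bar>f (u + v) - f u - g \<bullet> v\<bar> \<le> real CARD('d) ^ 2 * M * (norm v)\<^sup>2"
proof -
  obtain g h where g: "\<And>i. has_partial_derivative f i (g i)" and
    h: "\<And>i k. has_partial_derivative (g i) k (h i k)" "\<And>i k x. \<bar>h i k x\<bar> \<le> M"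
    using assms unfolding C2_bounded_def by blast
  have "M \<ge> 0" using h(2) by (meson abs_ge_zero order.trans)
  have "\<bar>f (u + v) - f u - (\<chi> i. g i u) \<bullet> v\<bar> \<le> real CARD('d) ^ 2 * M * (norm v)\<^sup>2" for v
  proof -
    have "\<bar>g i (u + w) - g i u\<bar> \<le> real CARD('d) * M * norm v" if "norm w \<le> norm v" for i w
    proof -
      have "\<bar>g i (u + w) - g i u - (\<Sum>i\<in>UNIV. 0 * w $ i)\<bar> \<le> real CARD('d) * M * norm w"
        by (rule has_partial_derivative_increment[OF h(1)]) (use h(2) in simp)
      also have "\<dots> \<le> real CARD('d) * M * norm v"
        using that \<open>M \<ge> 0\<close> by (intro mult_left_mono) auto
      finally show ?thesis by simp
    qed
    then have "\<bar>f (u + v) - f u - (\<Sum>i\<in>UNIV. g i u * v $ i)\<bar>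
        \<le> real CARD('d) * (real CARD('d) * M * norm v) * norm v"
      by (intro has_partial_derivative_increment[OF g])
    then show ?thesis
      by (simp add: inner_vec_def power2_eq_square mult_ac)
  qed
  then show ?thesis by blast
qed

text \<open>Every boundary point is touched by a ball of radius \<open>r\<close> from inside and by one from outside, with
centres on a common line.  The unit vector \<open>N\<close> is then the inner normal.\<close>

definition two_sided_ball :: "real \<Rightarrow> 'a::real_inner set \<Rightarrow> bool" where
  "two_sided_ball r \<Omega> \<longleftrightarrow> (\<forall>p\<in>frontier \<Omega>. \<exists>N. norm N = 1 \<and>
     ball (p + r *\<^sub>R N) r \<subseteq> interior \<Omega> \<and> ball (p - r *\<^sub>R N) r \<inter> \<Omega> = {})"

lemma ball_at_boundary_point_iff:
  fixes N h :: "'a::real_inner"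
  assumes "norm N = 1" "r > 0"
  shows "norm (h - r *\<^sub>R N) < r \<longleftrightarrow> (norm h)\<^sup>2 < 2 * r * (N \<bullet> h)"
proof -
  have "norm (h - r *\<^sub>R N) < r \<longleftrightarrow> (norm (h - r *\<^sub>R N))\<^sup>2 < r\<^sup>2"
    using assms by (auto intro: power_strict_mono power2_less_imp_less)
  also have "(norm (h - r *\<^sub>R N))\<^sup>2 = (norm h)\<^sup>2 - 2 * r * (N \<bullet> h) + r\<^sup>2"
    unfolding power2_norm_eq_inner using assms
    by (simp add: inner_diff_left inner_diff_right inner_commute norm_eq_1 power2_eq_square)
  finally show ?thesis by simp
qed

lemma C2_bounded_continuous:
  fixes f :: "real ^ 'd::finite \<Rightarrow> real"
  assumes "C2_bounded M f"
  shows "continuous_on UNIV f"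
proof (rule continuous_at_imp_continuous_on, rule ballI)
  fix u
  obtain g where g: "\<And>v. \<bar>f (u + v) - f u - g \<bullet> v\<bar> \<le> real CARD('d) ^ 2 * M * (norm v)\<^sup>2"
    using C2_bounded_taylor[OF assms] by blast
  have "((\<lambda>v. f (u + v) - f u) \<longlongrightarrow> 0) (at 0)"
  proof (rule Lim_null_comparison)
    show "\<forall>\<^sub>F v in at 0. norm (f (u + v) - f u) \<le> real CARD('d) ^ 2 * M * (norm v)\<^sup>2 + \<bar>g \<bullet> v\<bar>"
    proof (intro always_eventually allI)
      fix v
      show "norm (f (u + v) - f u) \<le> real CARD('d) ^ 2 * M * (norm v)\<^sup>2 + \<bar>g \<bullet> v\<bar>"
        using g[of v] unfolding real_norm_def by linarith
    qed
    have "((\<lambda>v. real CARD('d) ^ 2 * M * (norm v)\<^sup>2 + \<bar>g \<bullet> v\<bar>) \<longlongrightarrow>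
        real CARD('d) ^ 2 * M * (norm (0 :: real ^ 'd))\<^sup>2 + \<bar>g \<bullet> 0\<bar>) (at 0)"
      by (intro tendsto_intros)
    then show "((\<lambda>v. real CARD('d) ^ 2 * M * (norm v)\<^sup>2 + \<bar>g \<bullet> v\<bar>) \<longlongrightarrow> 0) (at 0)"
      by simp
  qed
  then show "isCont f u"
    by (simp add: isCont_iff LIM_zero_iff)
qed

text \<open>A point \<open>p + h\<close> of the ball of radius \<open>r\<close> that touches \<open>p\<close> in the direction \<open>N\<close> satisfies
\<open>\<bar>h\<bar>\<^sup>2 < 2 r (N \<bullet> h)\<close>.  In the coordinates of a chart, the deviation of the graph from its tangent plane
is at most \<open>K \<bar>h\<bar>\<^sup>2\<close>, and so for \<open>2 r K \<le> 1\<close> the ball stays on its side of the graph.  A Lebesgue number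
of the cover keeps it inside the chart.  The outer ball is treated alike, with \<open>- h\<close> in place of \<open>h\<close>.  No bound on the gradient of the graph is needed.\<close>

lemma C2_domain_two_sided_ball:
  fixes D :: "'d::finite space set"
  assumes "C2_domain D"
  shows "\<exists>r>0. two_sided_ball r (closure D)"
proof -
  from assms obtain \<delta> M :: real and J :: nat and U where
    D: "open D" "bounded D" and "M > 0" and
    U: "\<forall>j\<in>{1..J}. open (U j) \<and> connected (U j)" and
    cover: "frontier D \<subseteq> (\<Union>j\<in>{1..J}. U j)" and
    chart: "\<forall>j\<in>{1..J}. \<exists>T f. cartesian_coordinates T \<and> C2_bounded M f \<and>
           D \<inter> U j = {x \<in> U j. snd (T x) < f (fst (T x))}"
    unfolding C2_domain_def by (elim conjE exE) (rule that, assumption+)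
  have U_open: "open (U j)" if "j \<in> {1..J}" for j
    using U that by blast
  have "compact (frontier D)"
    using D by (simp add: compact_frontier_bounded)
  then obtain \<epsilon> where \<epsilon>: "\<epsilon> > 0" "\<And>p. p \<in> frontier D \<Longrightarrow> \<exists>G\<in>U ` {1..J}. ball p \<epsilon> \<subseteq> G"
    using cover U_open by (elim Heine_Borel_lemma[where \<G> = "U ` {1..J}"]) auto
  define K where "K = real CARD('d) ^ 2 * M"
  have "K > 0" using \<open>M > 0\<close> by (simp add: K_def)
  define r where "r = min (\<epsilon> / 2) (1 / (2 * K))"
  have r: "r > 0" "2 * r \<le> \<epsilon>" "K \<le> 1 / (2 * r)"
    using \<epsilon>(1) \<open>K > 0\<close> by (auto simp: r_def min_def field_simps)
  have "\<exists>N. norm N = 1 \<and> ball (p + r *\<^sub>R N) r \<subseteq> interior (closure D) \<and>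
      ball (p - r *\<^sub>R N) r \<inter> closure D = {}"
    if "p \<in> frontier (closure D)" for p
  proof -
    have p: "p \<in> frontier D"
      using that interior_mono[OF closure_subset[of D]] by (auto simp: frontier_def)
    then obtain j where j: "j \<in> {1..J}" "ball p \<epsilon> \<subseteq> U j"
      using \<epsilon>(2) by blast
    then obtain T f where T: "cartesian_coordinates T" and f: "C2_bounded M f" and
      DU: "D \<inter> U j = {x \<in> U j. snd (T x) < f (fst (T x))}"
      using chart by blast
    have DU_iff: "y \<in> D \<longleftrightarrow> snd (T y) < f (fst (T y))" if "y \<in> U j" for y
      using DU that by blast
    obtain Q a where Q: "orthogonal_transformation Q" and TQ: "T = (\<lambda>x. Q (x - a))"
      using T unfolding cartesian_coordinates_def by blast
    have "linear Q" using Q by (rule orthogonal_transformation_linear)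
    have Tdiff: "T y - T p = Q (y - p)" for y
      unfolding TQ by (simp add: linear_diff[OF \<open>linear Q\<close>])
    obtain u t where Tp: "T p = (u, t)" by fastforce
    have taylor: "\<exists>g. \<forall>v. \<bar>f (u + v) - f u - g \<bullet> v\<bar> \<le> K * (norm v)\<^sup>2" for u
      unfolding K_def by (rule C2_bounded_taylor[OF f])
    have f_cont: "continuous_on UNIV f"
      using f by (rule C2_bounded_continuous)
    have T_cont: "continuous_on UNIV T"
      unfolding TQ by (rule linear_continuous_on_compose[OF _ \<open>linear Q\<close>]) (intro continuous_intros)
    have tf: "t = f u"
    proof (rule ccontr)
      assume "t \<noteq> f u"
      then consider "t < f u" | "t > f u" by linarith
      then show False
      proof cases
        case 1
        have "p \<in> U j" using j(2) \<epsilon>(1) by auto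
        then have "p \<in> D" using 1 Tp by (simp add: DU_iff)
        then show False using p D by (simp add: frontier_def interior_open)
      next
        case 2
        have "continuous_on UNIV (\<lambda>x. f (fst (T x)))"
          by (rule continuous_on_compose2[OF f_cont continuous_on_fst[OF T_cont]]) simp
        then have "open {x. snd (T x) > f (fst (T x))}"
          by (rule open_Collect_less) (rule continuous_on_snd[OF T_cont])
        then have "open (U j \<inter> {x. snd (T x) > f (fst (T x))})"
          using U_open[OF j(1)] by blast
        moreover have "p \<in> U j \<inter> {x. snd (T x) > f (fst (T x))}"
          using 2 Tp j(2) \<epsilon>(1) by auto
        moreover have "(U j \<inter> {x. snd (T x) > f (fst (T x))}) \<inter> D = {}"
          using DU_iff by fastforce
        ultimately have "p \<notin> closure D"
          by (subst (asm) open_Int_closure_eq_empty[symmetric]) auto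
        then show False using p by (simp add: frontier_def)
      qed
    qed
    obtain g where g: "\<And>v. \<bar>f (u + v) - f u - g \<bullet> v\<bar> \<le> K * (norm v)\<^sup>2"
      using taylor by blast
    define c where "c = norm (g, - 1 :: real)"
    have c: "c \<ge> 1" using norm_snd_le[where x = g and y = "- 1 :: real"] by (simp add: c_def)
    \<comment> \<open>The unit normal of the graph that points below it, that is, into the domain.\<close>
    define N0 where "N0 = (1 / c) *\<^sub>R (g, - 1 :: real)"
    have N0: "norm N0 = 1" unfolding N0_def norm_scaleR c_def[symmetric] using c by simp
    have "surj Q" using Q by (rule orthogonal_transformation_surj)
    then obtain N where N: "Q N = N0" by (metis surjD)
    have "norm N = 1"
      using orthogonal_transformation_norm[OF Q, of N] N N0 by simp
    have key: "K * (norm (fst h))\<^sup>2 < g \<bullet> fst h - snd h"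
      if h: "(norm h)\<^sup>2 < 2 * r * (N0 \<bullet> h)" for h
    proof -
      have "N0 \<bullet> h = (g \<bullet> fst h - snd h) / c"
        by (cases h) (simp add: N0_def diff_divide_distrib)
      moreover have "N0 \<bullet> h > 0"
        using h r zero_le_power2[of "norm h"] by (smt (verit) mult_nonneg_nonpos)
      ultimately have "N0 \<bullet> h \<le> g \<bullet> fst h - snd h"
        using c mult_right_mono[of 1 c "N0 \<bullet> h"] by simp
      moreover have "(norm h)\<^sup>2 / (2 * r) < N0 \<bullet> h"
        using h r by (simp add: field_simps)
      moreover have "K * (norm (fst h))\<^sup>2 \<le> 1 / (2 * r) * (norm h)\<^sup>2"
        using r norm_fst_le[where x = "fst h" and y = "snd h"] by (intro mult_mono power_mono) auto
      ultimately show ?thesis by simp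
    qed
    have in_U: "y \<in> U j" if "y \<in> ball (p + s *\<^sub>R N) r" "\<bar>s\<bar> = r" for y s
    proof -
      have "dist p (p + s *\<^sub>R N) = r"
        using that \<open>norm N = 1\<close> by (simp add: dist_norm)
      then have "dist p y < \<epsilon>"
        using that r dist_triangle[of p y "p + s *\<^sub>R N"] by simp
      then show ?thesis using j(2) by auto
    qed
    have inner_ball: "ball (p + r *\<^sub>R N) r \<subseteq> D"
    proof
      fix y assume y: "y \<in> ball (p + r *\<^sub>R N) r"
      define h where "h = Q (y - p)"
      have "norm (h - r *\<^sub>R N0) = norm (Q ((y - p) - r *\<^sub>R N))"
        unfolding h_def N[symmetric] by (simp add: linear_diff[OF \<open>linear Q\<close>] linear_cmul[OF \<open>linear Q\<close>])
      also have "\<dots> < r"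
        using y by (simp add: orthogonal_transformation_norm[OF Q] dist_norm norm_minus_commute algebra_simps)
      finally have "K * (norm (fst h))\<^sup>2 < g \<bullet> fst h - snd h"
        using ball_at_boundary_point_iff[OF N0 r(1)] key by blast
      then have "t + snd h < f (u + fst h)"
        using g[of "fst h"] tf by linarith
      moreover have "T y = (u + fst h, t + snd h)"
        using Tdiff[of y] Tp by (simp add: h_def prod_eq_iff algebra_simps)
      moreover have "y \<in> U j" using in_U[of y r] y r by simp
      ultimately show "y \<in> D" by (simp add: DU_iff)
    qed
    have outer_ball: "ball (p - r *\<^sub>R N) r \<inter> D = {}"
    proof -
      have "y \<notin> D" if y: "y \<in> ball (p - r *\<^sub>R N) r" for y
      proof -
        define h where "h = Q (y - p)"
        have "norm (- h - r *\<^sub>R N0) = norm (Q (- (y - p) - r *\<^sub>R N))"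
          unfolding h_def N[symmetric]
          by (simp add: linear_diff[OF \<open>linear Q\<close>] linear_cmul[OF \<open>linear Q\<close>] linear_neg[OF \<open>linear Q\<close>])
        also have "\<dots> < r"
          using y by (simp add: orthogonal_transformation_norm[OF Q] dist_norm algebra_simps)
        finally have "K * (norm (fst (- h)))\<^sup>2 < g \<bullet> fst (- h) - snd (- h)"
          using ball_at_boundary_point_iff[OF N0 r(1)] key by blast
        then have "K * (norm (fst h))\<^sup>2 < snd h - g \<bullet> fst h"
          by (simp add: algebra_simps)
        then have "f (u + fst h) < t + snd h"
          using g[of "fst h"] tf by linarith
        moreover have "T y = (u + fst h, t + snd h)"
          using Tdiff[of y] Tp by (simp add: h_def prod_eq_iff algebra_simps)
        moreover have "y \<in> U j" using in_U[of y "- r"] y r by simp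
        ultimately show ?thesis by (simp add: DU_iff)
      qed
      then show ?thesis by blast
    qed
    have "ball (p + r *\<^sub>R N) r \<subseteq> interior (closure D)"
      using inner_ball interior_maximal[OF _ open_ball] closure_subset[of D] by blast
    moreover have "ball (p - r *\<^sub>R N) r \<inter> closure D = {}"
      using outer_ball by (simp add: open_Int_closure_eq_empty)
    ultimately show ?thesis using \<open>norm N = 1\<close> by blast
  qed
  then have "two_sided_ball r (closure D)"
    unfolding two_sided_ball_def by blast
  then show ?thesis using r(1) by blast
qed

section \<open>Quadratic approximation of the distance to the boundary\<close>

lemma norm_shift_upper:
  fixes N w :: "'a::real_inner"
  assumes "norm N = 1" "R > 0"
  shows "norm (w + R *\<^sub>R N) \<le> R + N \<bullet> w + (norm w)\<^sup>2 / (2 * R)"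
proof -
  define X where "X = norm (w + R *\<^sub>R N)"
  have "X\<^sup>2 = (norm w)\<^sup>2 + 2 * R * (N \<bullet> w) + R\<^sup>2"
    unfolding X_def power2_norm_eq_inner using assms
    by (simp add: inner_add_left inner_add_right inner_commute norm_eq_1 power2_eq_square)
  moreover have "2 * R * X \<le> X\<^sup>2 + R\<^sup>2"
    using zero_le_power2[of "X - R"] by (simp add: power2_diff mult_ac)
  moreover have "2 * R * (R + N \<bullet> w + (norm w)\<^sup>2 / (2 * R)) = 2 * R\<^sup>2 + 2 * R * (N \<bullet> w) + (norm w)\<^sup>2"
    using assms by (simp add: distrib_left power2_eq_square)
  ultimately have "2 * R * X \<le> 2 * R * (R + N \<bullet> w + (norm w)\<^sup>2 / (2 * R))"
    by linarith
  then show ?thesis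
    using assms unfolding X_def by simp
qed

text \<open>Near the boundary, the distance to the boundary is affine up to a quadratic error.  With \<open>p\<close> the
boundary point nearest to \<open>t\<close> and \<open>N\<close> the inner normal there, the distance of \<open>x\<close> to the outer
touching ball bounds the boundary distance from above, and the distance of \<open>x\<close> to the complement of the
inner touching ball bounds it from below; both have the expansion \<open>N \<bullet> (x - p)\<close> around \<open>t\<close>.\<close>

lemma infdist_frontier_quadratic:
  fixes \<Omega> :: "'a::euclidean_space set"
  assumes \<Omega>: "compact \<Omega>" "\<Omega> \<noteq> {}" and r: "r > 0" "two_sided_ball r \<Omega>"
    and t: "t \<in> \<Omega>" "infdist t (frontier \<Omega>) \<le> r / 2"
  shows "\<exists>N p. norm N = 1 \<and> p \<in> \<Omega> \<and>
    (\<forall>x\<in>\<Omega>. \<bar>infdist x (frontier \<Omega>) - N \<bullet> (x - p)\<bar> \<le> (norm (x - t))\<^sup>2 / r)"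
proof -
  let ?\<Gamma> = "frontier \<Omega>"
  define s where "s = infdist t ?\<Gamma>"
  have ne: "?\<Gamma> \<noteq> {}"
    using \<Omega> by (metis frontier_eq_empty compact_imp_bounded not_bounded_UNIV)
  have sub: "?\<Gamma> \<subseteq> \<Omega>" using \<Omega> compact_imp_closed frontier_subset_eq by blast
  obtain p where p: "p \<in> ?\<Gamma>" "s = dist t p"
    unfolding s_def using infdist_attains_inf[OF frontier_closed ne] by blast
  have s: "0 \<le> s" "s \<le> r / 2" using t by (auto simp: s_def infdist_nonneg)
  obtain N where N: "norm N = 1" "ball (p + r *\<^sub>R N) r \<subseteq> interior \<Omega>" "ball (p - r *\<^sub>R N) r \<inter> \<Omega> = {}"
    using r p unfolding two_sided_ball_def by blast
  have outer: "infdist x ?\<Gamma> \<le> norm (x - (p - r *\<^sub>R N)) - r" if "x \<in> \<Omega>" for x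
  proof -
    let ?c = "p - r *\<^sub>R N"
    have "?c \<in> ball ?c r" using r by simp
    then have "?c \<notin> \<Omega>" using N by blast
    then have "closed_segment x ?c \<inter> ?\<Gamma> \<noteq> {}"
      using that by (intro connected_Int_frontier) (auto intro: exI[of _ x] exI[of _ ?c])
    then obtain y where y: "y \<in> closed_segment x ?c" "y \<in> ?\<Gamma>" by blast
    then have "y \<notin> ball ?c r" using N sub by blast
    then have "r \<le> dist y ?c" by (simp add: dist_commute)
    moreover have "dist x y + dist y ?c = dist x ?c"
      using y between[of x ?c y] by (simp add: between_mem_segment)
    ultimately show ?thesis
      using infdist_le[OF y(2), of x] by (simp add: dist_norm)
  qed
  have inner: "r - norm (x - (p + r *\<^sub>R N)) \<le> infdist x ?\<Gamma>" for x
  proof -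
    have "r - norm (x - (p + r *\<^sub>R N)) \<le> dist x y" if "y \<in> ?\<Gamma>" for y
    proof -
      have "y \<notin> ball (p + r *\<^sub>R N) r" using that N by (auto simp: frontier_def)
      then have "r \<le> dist y (p + r *\<^sub>R N)" by (simp add: dist_commute)
      then show ?thesis
        using dist_triangle[of y "p + r *\<^sub>R N" x] by (simp add: dist_norm norm_minus_commute)
    qed
    then show ?thesis
      by (subst infdist_notempty[OF ne]) (intro cINF_greatest ne)
  qed
  \<comment> \<open>The outer ball forces equality in the triangle inequality for \<open>t - p\<close> and \<open>r N\<close>.\<close>
  have t_eq: "t = p + s *\<^sub>R N"
  proof -
    have "s + r \<le> norm (t - (p - r *\<^sub>R N))"
      using outer[OF t(1)] by (simp add: s_def)
    moreover have "t - (p - r *\<^sub>R N) = (t - p) + r *\<^sub>R N" by simp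
    moreover have "norm (t - p) = s" "norm (r *\<^sub>R N) = r"
      using p N r by (auto simp: dist_norm)
    ultimately have "norm ((t - p) + r *\<^sub>R N) = norm (t - p) + norm (r *\<^sub>R N)"
      using norm_triangle_ineq[of "t - p" "r *\<^sub>R N"] by simp
    then have "norm (t - p) *\<^sub>R (r *\<^sub>R N) = norm (r *\<^sub>R N) *\<^sub>R (t - p)"
      using norm_triangle_eq by blast
    then have "r *\<^sub>R (s *\<^sub>R N) = r *\<^sub>R (t - p)"
      using \<open>norm (t - p) = s\<close> \<open>norm (r *\<^sub>R N) = r\<close> by (simp add: mult.commute)
    then have "s *\<^sub>R N = t - p"
      using r by (simp only: scaleR_cancel_left) auto
    then show ?thesis by simp
  qed
  have "\<bar>infdist x ?\<Gamma> - N \<bullet> (x - p)\<bar> \<le> (norm (x - t))\<^sup>2 / r" if x: "x \<in> \<Omega>" for x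
  proof -
    have NN: "N \<bullet> N = 1" using N(1) by (simp add: norm_eq_1)
    have Np: "N \<bullet> (x - p) = s + N \<bullet> (x - t)"
      unfolding t_eq by (simp add: inner_diff_right inner_add_right NN)
    have "infdist x ?\<Gamma> \<le> norm ((x - t) + (r + s) *\<^sub>R N) - r"
      using outer[OF x] by (simp add: t_eq algebra_simps)
    also have "\<dots> \<le> s + N \<bullet> (x - t) + (norm (x - t))\<^sup>2 / (2 * (r + s))"
      using norm_shift_upper[OF N(1), of "r + s" "x - t"] r s by simp
    also have "\<dots> \<le> s + N \<bullet> (x - t) + (norm (x - t))\<^sup>2 / r"
      using r s by (intro add_left_mono divide_left_mono) auto
    finally have up: "infdist x ?\<Gamma> \<le> s + N \<bullet> (x - t) + (norm (x - t))\<^sup>2 / r" .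
    have "norm (x - (p + r *\<^sub>R N)) = norm ((x - t) + (r - s) *\<^sub>R (- N))"
      by (rule arg_cong[where f = norm]) (simp add: t_eq algebra_simps)
    also have "\<dots> \<le> (r - s) + (- N) \<bullet> (x - t) + (norm (x - t))\<^sup>2 / (2 * (r - s))"
      using N r s by (intro norm_shift_upper) auto
    also have "\<dots> \<le> (r - s) + (- N) \<bullet> (x - t) + (norm (x - t))\<^sup>2 / r"
      using r s by (intro add_left_mono divide_left_mono) auto
    finally have "s + N \<bullet> (x - t) - (norm (x - t))\<^sup>2 / r \<le> infdist x ?\<Gamma>"
      using inner[of x] by simp
    with up show ?thesis
      unfolding Np by (simp add: abs_le_iff)
  qed
  then show ?thesis using N p sub by blast
qed

lemma abs_sqrt_diff_le_sqrt:
  assumes "0 \<le> a" "0 \<le> (b::real)"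
  shows "\<bar>sqrt a - sqrt b\<bar> \<le> sqrt \<bar>a - b\<bar>"
proof -
  have "sqrt x \<le> sqrt y + sqrt \<bar>x - y\<bar>" if "0 \<le> x" "0 \<le> y" for x y :: real
  proof -
    have "sqrt x \<le> sqrt (y + \<bar>x - y\<bar>)" by (intro real_sqrt_le_mono) auto
    also have "\<dots> \<le> sqrt y + sqrt \<bar>x - y\<bar>"
      using that by (intro sqrt_add_le_add_sqrt) auto
    finally show ?thesis .
  qed
  from this[of a b] this[of b a] show ?thesis
    using assms by (simp add: abs_le_iff abs_minus_commute)
qed

text \<open>A polynomial \<open>\<phi>\<close> of degree at most two whose square root can replace the square root of the boundary
distance near \<open>t\<close>: the metric \<open>rho\<close> between two points is controlled by their Euclidean distances to
\<open>t\<close> and by the difference of the values of \<open>sqrt \<phi>\<close>, which lie in \<open>[0, R]\<close>.\<close>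

definition quadratic_chart :: "nat \<Rightarrow> real \<Rightarrow> 'a::euclidean_space set \<Rightarrow> 'a \<Rightarrow> ('a \<Rightarrow> real) \<Rightarrow> bool" where
  "quadratic_chart R C \<Omega> t \<phi> \<longleftrightarrow> \<phi> \<in> poly_space 2 \<and> (\<forall>x\<in>\<Omega>. 0 \<le> \<phi> x \<and> \<phi> x \<le> (real R)\<^sup>2) \<and>
     (\<forall>x\<in>\<Omega>. \<forall>z\<in>\<Omega>. rho \<Omega> x z \<le>
        C * (norm (x - t) + norm (z - t) + \<bar>sqrt (\<phi> x) - sqrt (\<phi> z)\<bar>))"

lemma poly_space_norm_square:
  fixes t :: "'a::euclidean_space"
  shows "(\<lambda>x. (norm (x - t))\<^sup>2) \<in> poly_space 2"
proof -
  have "(\<lambda>x. (norm (x - t))\<^sup>2) = (\<lambda>x. \<Sum>b\<in>Basis. (x \<bullet> b + - (t \<bullet> b)) ^ 2)"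
    unfolding power2_norm_eq_inner
    by (subst euclidean_inner) (simp add: inner_diff_left power2_eq_square)
  moreover have "\<dots> \<in> poly_space (2 * 1)"
    by (intro poly_space_sum poly_space_power poly_space_add poly_space_inner poly_space_const) simp
  ultimately show ?thesis by simp
qed

text \<open>If \<open>t\<close> is close to the boundary, then \<open>\<phi>\<close> is the affine approximation of the boundary distance plus
its quadratic error bound.  This makes \<open>\<phi>\<close> nonnegative and at distance \<open>O(\<bar>x - t\<bar>\<^sup>2)\<close> from the boundary
distance, so the square roots of the two differ by \<open>O(\<bar>x - t\<bar>)\<close>.  If \<open>t\<close> is far from the boundary, the
root of the boundary distance is Lipschitz near \<open>t\<close>, and \<open>\<phi> = 0\<close> suffices.\<close>

lemma quadratic_chart_exists:
  fixes \<Omega> :: "'a::euclidean_space set"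
  assumes \<Omega>: "compact \<Omega>" "\<Omega> \<noteq> {}" and r: "r > 0" "two_sided_ball r \<Omega>"
  shows "\<exists>R C. C > 0 \<and> (\<forall>t\<in>\<Omega>. \<exists>\<phi>. quadratic_chart R C \<Omega> t \<phi>)"
proof -
  let ?d = "\<lambda>x. infdist x (frontier \<Omega>)"
  define d where "d = diameter \<Omega>"
  have bdd: "bounded \<Omega>" using \<Omega> compact_imp_bounded by blast
  have d: "norm (x - y) \<le> d" if "x \<in> \<Omega>" "y \<in> \<Omega>" for x y
    using diameter_bounded_bound[OF bdd that] by (simp add: d_def dist_norm)
  have "d \<ge> 0" using bdd by (simp add: d_def diameter_ge_0)
  have ne: "frontier \<Omega> \<noteq> {}"
    using \<Omega> bdd by (metis frontier_eq_empty not_bounded_UNIV)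
  have sub: "frontier \<Omega> \<subseteq> \<Omega>" using \<Omega> compact_imp_closed frontier_subset_eq by blast
  have dist_le: "?d x \<le> d" if "x \<in> \<Omega>" for x
  proof -
    obtain y where "y \<in> frontier \<Omega>" using ne by blast
    then show ?thesis
      using infdist_le[of y "frontier \<Omega>" x] d[of x y] that sub by (auto simp: dist_norm)
  qed
  define R where "R = nat \<lceil>sqrt (d + 2 * d\<^sup>2 / r)\<rceil>"
  have R: "d + 2 * d\<^sup>2 / r \<le> (real R)\<^sup>2"
  proof -
    have "sqrt (d + 2 * d\<^sup>2 / r) \<le> real R" by (simp add: R_def real_nat_ceiling_ge)
    then show ?thesis using sqrt_le_D by blast
  qed
  define C1 where "C1 = 1 + sqrt (2 / r)"
  define C2 where "C2 = 1 + 4 * sqrt d / r + 1 / sqrt (r / 4)"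
  have C: "C1 \<ge> 1" "C2 \<ge> 1"
    using r \<open>d \<ge> 0\<close> by (auto simp: C1_def C2_def)
  have "\<exists>\<phi>. quadratic_chart R (C1 + C2) \<Omega> t \<phi>" if t: "t \<in> \<Omega>" for t
  proof (cases "?d t \<le> r / 2")
    case True
    then obtain N p where N: "norm N = 1" and p: "p \<in> \<Omega>" and
      approx: "\<And>x. x \<in> \<Omega> \<Longrightarrow> \<bar>?d x - N \<bullet> (x - p)\<bar> \<le> (norm (x - t))\<^sup>2 / r"
      using infdist_frontier_quadratic[OF \<Omega> r t] by blast
    \<comment> \<open>Written as a sum of members of the polynomial space; the next fact gives the readable form.\<close>
    define \<phi> where "\<phi> x = (x \<bullet> N + - (p \<bullet> N)) + 1 / r * (norm (x - t))\<^sup>2" for x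
    have \<phi>: "\<phi> x = N \<bullet> (x - p) + (norm (x - t))\<^sup>2 / r" for x
      by (simp add: \<phi>_def inner_diff_right inner_commute)
    have \<phi>_bounds: "?d x \<le> \<phi> x" "\<phi> x \<le> ?d x + 2 * (norm (x - t))\<^sup>2 / r" if "x \<in> \<Omega>" for x
      using approx[OF that] unfolding \<phi> by (auto simp: abs_le_iff)
    have \<phi>_nonneg: "0 \<le> \<phi> x" if "x \<in> \<Omega>" for x
      using \<phi>_bounds(1)[OF that] infdist_nonneg order.trans by blast
    have \<phi>_le: "\<phi> x \<le> (real R)\<^sup>2" if "x \<in> \<Omega>" for x
    proof -
      have "2 * (norm (x - t))\<^sup>2 / r \<le> 2 * d\<^sup>2 / r"
        using d[OF that t] r by (intro divide_right_mono mult_left_mono power_mono) auto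
      then show ?thesis
        using \<phi>_bounds(2)[OF that] dist_le[OF that] R by linarith
    qed
    have sqrt_close: "\<bar>sqrt (?d x) - sqrt (\<phi> x)\<bar> \<le> sqrt (2 / r) * norm (x - t)" if "x \<in> \<Omega>" for x
    proof -
      have "\<bar>sqrt (?d x) - sqrt (\<phi> x)\<bar> \<le> sqrt \<bar>?d x - \<phi> x\<bar>"
        using \<phi>_nonneg[OF that] by (intro abs_sqrt_diff_le_sqrt infdist_nonneg)
      also have "\<dots> \<le> sqrt (2 / r * (norm (x - t))\<^sup>2)"
        using \<phi>_bounds[OF that] by (intro real_sqrt_le_mono) auto
      also have "\<dots> = sqrt (2 / r) * norm (x - t)"
        unfolding real_sqrt_mult by simp
      finally show ?thesis .
    qed
    have "rho \<Omega> x z \<le> (C1 + C2) * (norm (x - t) + norm (z - t) + \<bar>sqrt (\<phi> x) - sqrt (\<phi> z)\<bar>)"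
      if x: "x \<in> \<Omega>" and z: "z \<in> \<Omega>" for x z
    proof -
      define b where "b = sqrt (2 / r)"
      define X where "X = norm (x - t)"
      define Z where "Z = norm (z - t)"
      define Y where "Y = \<bar>sqrt (\<phi> x) - sqrt (\<phi> z)\<bar>"
      have nn: "0 \<le> X" "0 \<le> Z" "0 \<le> Y" by (auto simp: X_def Z_def Y_def)
      have "norm (x - z) \<le> X + Z"
        unfolding X_def Z_def using norm_triangle_ineq4[of "x - t" "z - t"] by simp
      moreover have "\<bar>sqrt (?d x) - sqrt (?d z)\<bar> \<le> b * X + b * Z + Y"
        using sqrt_close[OF x] sqrt_close[OF z] unfolding b_def X_def Z_def Y_def by linarith
      ultimately have "rho \<Omega> x z \<le> X + Z + b * X + b * Z + Y"
        by (simp add: rho_def)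
      also have "\<dots> \<le> C1 * (X + Z + Y)"
        using nn r by (simp add: C1_def b_def algebra_simps)
      also have "\<dots> \<le> (C1 + C2) * (X + Z + Y)"
        using nn C by (intro mult_right_mono) auto
      finally show ?thesis unfolding X_def Z_def Y_def .
    qed
    moreover have "\<phi> \<in> poly_space 2"
      unfolding \<phi>_def
      by (intro poly_space_add poly_space_cmult poly_space_inner poly_space_const poly_space_norm_square) simp
    ultimately show ?thesis
      unfolding quadratic_chart_def using \<phi>_nonneg \<phi>_le by blast
  next
    case False
    have rho_le: "rho \<Omega> x z \<le> (C1 + C2) * (norm (x - t) + norm (z - t))" if x: "x \<in> \<Omega>" and z: "z \<in> \<Omega>" for x z
    proof -
      define S where "S = norm (x - t) + norm (z - t)"
      have "S \<ge> 0" by (simp add: S_def)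
      have xz: "norm (x - z) \<le> S"
        unfolding S_def using norm_triangle_ineq4[of "x - t" "z - t"] by simp
      have "\<bar>sqrt (?d x) - sqrt (?d z)\<bar> \<le> (4 * sqrt d / r + 1 / sqrt (r / 4)) * S"
      proof (cases "S \<le> r / 4")
        case True
        have "\<bar>?d x - ?d t\<bar> \<le> norm (x - t)"
          using infdist_triangle_abs[of x "frontier \<Omega>" t] by (simp add: dist_norm)
        then have dx: "?d x \<ge> r / 4"
          using True False norm_ge_zero[of "z - t"] unfolding S_def by linarith
        have "\<bar>sqrt (?d x) - sqrt (?d z)\<bar> * sqrt (r / 4) \<le>
            \<bar>sqrt (?d x) - sqrt (?d z)\<bar> * (sqrt (?d x) + sqrt (?d z))"
          using dx by (intro mult_left_mono add_increasing2) (auto simp: infdist_nonneg)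
        also have "\<dots> = \<bar>?d x - ?d z\<bar>"
        proof -
          have "(sqrt (?d x) - sqrt (?d z)) * (sqrt (?d x) + sqrt (?d z)) = ?d x - ?d z"
            by (simp add: algebra_simps infdist_nonneg)
          moreover have "sqrt (?d x) + sqrt (?d z) \<ge> 0" by (simp add: infdist_nonneg)
          ultimately show ?thesis by (metis abs_mult abs_of_nonneg)
        qed
        also have "\<dots> \<le> S"
          using infdist_triangle_abs[of x "frontier \<Omega>" z] xz by (simp add: dist_norm)
        finally have "\<bar>sqrt (?d x) - sqrt (?d z)\<bar> \<le> 1 / sqrt (r / 4) * S"
          using r by (simp add: field_simps)
        also have "\<dots> \<le> (4 * sqrt d / r + 1 / sqrt (r / 4)) * S"
          using r \<open>d \<ge> 0\<close> \<open>S \<ge> 0\<close> by (intro mult_right_mono) auto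
        finally show ?thesis .
      next
        case False
        have "sqrt (?d x) \<le> sqrt d" "sqrt (?d z) \<le> sqrt d" "sqrt (?d x) \<ge> 0" "sqrt (?d z) \<ge> 0"
          using dist_le x z by (auto simp: infdist_nonneg)
        then have "\<bar>sqrt (?d x) - sqrt (?d z)\<bar> \<le> sqrt d" by linarith
        also have "\<dots> = 4 * sqrt d / r * (r / 4)" using r by simp
        also have "\<dots> \<le> 4 * sqrt d / r * S"
          using False r \<open>d \<ge> 0\<close> by (intro mult_left_mono) auto
        also have "\<dots> \<le> (4 * sqrt d / r + 1 / sqrt (r / 4)) * S"
          using r \<open>d \<ge> 0\<close> \<open>S \<ge> 0\<close> by (intro mult_right_mono) auto
        finally show ?thesis .
      qed
      then have "rho \<Omega> x z \<le> C2 * S"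
        using xz by (simp add: rho_def C2_def distrib_right)
      also have "\<dots> \<le> (C1 + C2) * S"
        using C \<open>S \<ge> 0\<close> by (intro mult_right_mono) auto
      finally show ?thesis unfolding S_def .
    qed
    have "quadratic_chart R (C1 + C2) \<Omega> t (\<lambda>_. 0)"
      unfolding quadratic_chart_def using rho_le by (auto intro: poly_space_const)
    then show ?thesis by blast
  qed
  then show ?thesis using C by (intro exI[of _ R] exI[of _ "C1 + C2"]) auto
qed

section \<open>Localized polynomial partitions of unity\<close>

lemma rho_self: "rho \<Omega> x x = 0"
  by (simp add: rho_def)

lemma rho_commute: "rho \<Omega> x y = rho \<Omega> y x"
  by (simp add: rho_def norm_minus_commute abs_minus_commute)

lemma rho_nonneg: "0 \<le> rho \<Omega> x y"
  by (simp add: rho_def)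

lemma rho_triangle: "rho \<Omega> x z \<le> rho \<Omega> x y + rho \<Omega> y z"
  unfolding rho_def using norm_triangle_ineq[of "x - y" "y - z"] by simp

lemma maximal_separated_subset:
  assumes "finite Z" "\<epsilon> > 0" "\<And>x. r x x = 0" "\<And>x y. r x y = r y x"
  shows "\<exists>\<Lambda>\<subseteq>Z. separated r \<epsilon> \<Lambda> \<and> (\<forall>z\<in>Z. \<exists>\<xi>\<in>\<Lambda>. r z \<xi> < \<epsilon>)"
  using assms(1)
proof (induction Z rule: finite_induct)
  case empty
  show ?case by (simp add: separated_def)
next
  case (insert z Z)
  then obtain \<Lambda> where \<Lambda>: "\<Lambda> \<subseteq> Z" "separated r \<epsilon> \<Lambda>" "\<forall>z\<in>Z. \<exists>\<xi>\<in>\<Lambda>. r z \<xi> < \<epsilon>"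
    by blast
  show ?case
  proof (cases "\<exists>\<xi>\<in>\<Lambda>. r z \<xi> < \<epsilon>")
    case True
    then show ?thesis using \<Lambda> by (intro exI[of _ \<Lambda>]) auto
  next
    case False
    have "separated r \<epsilon> (insert z \<Lambda>)"
      unfolding separated_def
    proof (intro ballI impI)
      fix x y
      assume "x \<in> insert z \<Lambda>" "y \<in> insert z \<Lambda>" "x \<noteq> y"
      then consider "x \<in> \<Lambda>" "y \<in> \<Lambda>" | "x = z" "y \<in> \<Lambda>" | "y = z" "x \<in> \<Lambda>" by blast
      then show "\<epsilon> \<le> r x y"
      proof cases
        case 1
        then show ?thesis using \<Lambda>(2) \<open>x \<noteq> y\<close> by (simp add: separated_def)
      next
        case 2
        then show ?thesis using False by force
      next
        case 3
        then show ?thesis using False assms(4)[of x y] by force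
      qed
    qed
    then show ?thesis
      using \<Lambda> assms(2,3) by (intro exI[of _ "insert z \<Lambda>"]) auto
  qed
qed

lemma one_plus_sum_le_prod:
  fixes a :: "'i \<Rightarrow> real"
  assumes "finite A" "\<And>i. i \<in> A \<Longrightarrow> 0 \<le> a i"
  shows "1 + sum a A \<le> (\<Prod>i\<in>A. 1 + a i)"
  using assms
proof (induction A rule: finite_induct)
  case (insert j A)
  have "0 \<le> a j" "0 \<le> sum a A" using insert by (auto intro: sum_nonneg)
  then have "1 + sum a (insert j A) \<le> (1 + a j) * (1 + sum a A)"
    using insert by (simp add: algebra_simps)
  also have "\<dots> \<le> (1 + a j) * (\<Prod>i\<in>A. 1 + a i)"
    using insert \<open>0 \<le> a j\<close> by (intro mult_left_mono) auto
  finally show ?case using insert by simp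
qed simp

text \<open>A partition of unity on \<open>\<Omega>\<close> into polynomials of degree at most \<open>s\<close>, indexed by a finite
\<open>1 / n\<close>-separated subset of \<open>\<Omega>\<close>; each polynomial decays away from its point to the order \<open>l\<close> at
the scale \<open>1 / n\<close>, with constant \<open>C\<close>.\<close>

definition localized_partition ::
  "'a::euclidean_space set \<Rightarrow> real \<Rightarrow> real \<Rightarrow> nat \<Rightarrow> nat \<Rightarrow> bool" where
  "localized_partition \<Omega> l C s n \<longleftrightarrow> (\<exists>\<Lambda> P. finite \<Lambda> \<and> \<Lambda> \<subseteq> \<Omega> \<and>
     separated (rho \<Omega>) (1 / real n) \<Lambda> \<and> (\<forall>\<xi>\<in>\<Lambda>. P \<xi> \<in> poly_space s) \<and>
     (\<forall>x\<in>\<Omega>. (\<Sum>\<xi>\<in>\<Lambda>. P \<xi> x) = 1 \<and>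
       (\<forall>\<xi>\<in>\<Lambda>. \<bar>P \<xi> x\<bar> \<le> C * (1 + real n * rho \<Omega> x \<xi>) powr (- l))))"

lemma localized_partitionE:
  assumes "localized_partition \<Omega> l C s n"
  obtains \<Lambda> P where "finite \<Lambda>" "\<Lambda> \<subseteq> \<Omega>" "separated (rho \<Omega>) (1 / real n) \<Lambda>"
    "\<And>\<xi>. \<xi> \<in> \<Lambda> \<Longrightarrow> P \<xi> \<in> poly_space s" "\<And>x. x \<in> \<Omega> \<Longrightarrow> (\<Sum>\<xi>\<in>\<Lambda>. P \<xi> x) = 1"
    "\<And>x \<xi>. x \<in> \<Omega> \<Longrightarrow> \<xi> \<in> \<Lambda> \<Longrightarrow> \<bar>P \<xi> x\<bar> \<le> C * (1 + real n * rho \<Omega> x \<xi>) powr (- l)"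
proof -
  from assms obtain \<Lambda> P where "finite \<Lambda> \<and> \<Lambda> \<subseteq> \<Omega> \<and>
     separated (rho \<Omega>) (1 / real n) \<Lambda> \<and> (\<forall>\<xi>\<in>\<Lambda>. P \<xi> \<in> poly_space s) \<and>
     (\<forall>x\<in>\<Omega>. (\<Sum>\<xi>\<in>\<Lambda>. P \<xi> x) = 1 \<and>
       (\<forall>\<xi>\<in>\<Lambda>. \<bar>P \<xi> x\<bar> \<le> C * (1 + real n * rho \<Omega> x \<xi>) powr (- l)))"
    unfolding localized_partition_def by (elim exE) (rule that)
  then show thesis by (intro that[of \<Lambda> P]) simp_all
qed
text \<open>A product of one-dimensional partitions in the coordinates localizes at the points of a grid of width
\<open>1 / n\<close>.  Each of its members, with multi-index \<open>\<alpha>\<close>, is multiplied by a partition of unity in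
\<open>sqrt \<phi>\<close>, where \<open>\<phi>\<close> is a quadratic chart at the point \<open>t \<alpha>\<close> of \<open>\<Omega>\<close> closest to the grid point.  This
second partition may depend on \<open>\<alpha>\<close>, because it sums to \<open>1\<close> exactly.  The resulting products \<open>F i\<close> decay
with the deviation \<open>G i x\<close> of \<open>x\<close> from the parameters of \<open>i\<close>.  The centre \<open>z i\<close> of \<open>F i\<close> is a minimizer of
\<open>G i\<close> on \<open>\<Omega>\<close>, so that \<open>n rho x (z i)\<close> is bounded by a multiple of \<open>G i x\<close> wherever the grid
point may lie.  Finally, the \<open>F i\<close> are grouped by a nearby point \<open>\<sigma> i\<close> of a maximal separated set of
centres; the two additional powers of decay in the weight \<open>w\<close> bound the
sum over a group uniformly in \<open>n\<close>.\<close>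

lemma localized_partition_exists:
  fixes \<Omega> :: "'a::euclidean_space set"
  assumes \<Omega>: "compact \<Omega>" "\<Omega> \<noteq> {}" and "C0 > 0" and
    charts: "\<forall>t\<in>\<Omega>. \<exists>\<phi>. quadratic_chart R0 C0 \<Omega> t \<phi>" and l: "l > 0"
  shows "\<exists>K C. C > 0 \<and> (\<forall>n\<ge>1. localized_partition \<Omega> l C (K * n) n)"
proof -
  obtain \<phi> where \<phi>: "\<And>t. t \<in> \<Omega> \<Longrightarrow> quadratic_chart R0 C0 \<Omega> t (\<phi> t)"
    using charts by metis
  obtain R1 :: nat where R1: "\<And>x. x \<in> \<Omega> \<Longrightarrow> norm x \<le> real R1"
  proof -
    obtain B where B: "\<And>x. x \<in> \<Omega> \<Longrightarrow> norm x \<le> B"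
      using \<Omega>(1) compact_imp_bounded bounded_iff by metis
    have "norm x \<le> real (nat \<lceil>B\<rceil>)" if "x \<in> \<Omega>" for x
      using B[OF that] real_nat_ceiling_ge[of B] by linarith
    then show ?thesis using that by blast
  qed
  \<comment> \<open>Large enough for the shifted coordinates \<open>x \<bullet> b + R1\<close> in \<open>[0, 2 R1]\<close> and for \<open>sqrt \<phi>\<close> in \<open>[0, R0]\<close>.\<close>
  define R where "R = R0 + 2 * R1 + 1"
  define m where "m = nat \<lceil>l\<rceil>"
  have m: "l \<le> real m" by (simp add: m_def real_nat_ceiling_ge)
  have R: "R \<ge> 1" by (simp add: R_def)
  have "m + 2 \<ge> 1" by simp
  from poly_partition_of_unity_1d[OF this R] obtain C1 K1 where "C1 > 0" and
    part: "\<And>n. n \<ge> 1 \<Longrightarrow> \<exists>q :: nat \<Rightarrow> real poly.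
     (\<forall>k. degree (q k) \<le> K1 * n) \<and> (\<forall>s. (\<Sum>k\<le>R * n. poly (q k) s) = 1) \<and>
     (\<forall>k\<le>R * n. \<forall>v\<in>{0..real R}. \<bar>poly (q k) (v\<^sup>2)\<bar> \<le> C1 / (1 + \<bar>real n * v - real k\<bar>) ^ (m + 2))"
    by metis
  define C5 where "C5 = 2 + 4 * C0"
  define C where "C = C1 ^ (DIM('a) + 1) * C5 powr l * 4 ^ (DIM('a) + 1)"
  define K where "K = 2 * (DIM('a) + 1) * K1"
  have "C5 > 0" using \<open>C0 > 0\<close> by (simp add: C5_def)
  then have "C > 0" using \<open>C1 > 0\<close> by (simp add: C_def)
  have "localized_partition \<Omega> l C (K * n) n" if n: "n \<ge> 1" for n
  proof -
    obtain q :: "nat \<Rightarrow> real poly" where dq: "\<And>k. degree (q k) \<le> K1 * n" and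
      q_sum: "\<And>s. (\<Sum>k\<le>R * n. poly (q k) s) = 1" and
      q_le: "\<And>k v. k \<le> R * n \<Longrightarrow> 0 \<le> v \<Longrightarrow> v \<le> real R \<Longrightarrow>
        \<bar>poly (q k) (v\<^sup>2)\<bar> \<le> C1 / (1 + \<bar>real n * v - real k\<bar>) ^ (m + 2)"
      using part[OF n] by force
    define grid where "grid \<alpha> = (\<Sum>b\<in>Basis. (real (\<alpha> b) / real n - real R1) *\<^sub>R b)" for \<alpha> :: "'a \<Rightarrow> nat"
    define t where "t \<alpha> = closest_point \<Omega> (grid \<alpha>)" for \<alpha>
    have "closed \<Omega>" using \<Omega> compact_imp_closed by blast
    have t: "t \<alpha> \<in> \<Omega>" for \<alpha>
      unfolding t_def by (rule closest_point_in_set[OF \<open>closed \<Omega>\<close> \<Omega>(2)])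
    note chart = \<phi>[OF t, unfolded quadratic_chart_def]
    define A where "A \<alpha> b x = \<bar>real n * (x \<bullet> b + real R1) - real (\<alpha> b)\<bar>" for \<alpha> and b x :: 'a
    define B where "B \<alpha> k x = \<bar>real n * sqrt (\<phi> (t \<alpha>) x) - real k\<bar>" for \<alpha> and k :: nat and x
    define G where "G i x = (\<Sum>b\<in>Basis. A (fst i) b x) + B (fst i) (snd i) x" for i x
    define w where "w i x = (\<Prod>b\<in>Basis. 1 / (1 + A (fst i) b x) ^ 2) * (1 / (1 + B (fst i) (snd i) x) ^ 2)" for i x
    define F where "F i x = (\<Prod>b\<in>Basis. poly (q (fst i b)) ((x \<bullet> b + real R1)\<^sup>2)) *
        poly (q (snd i)) (\<phi> (t (fst i)) x)" for i x
    define I where "I = (Basis \<rightarrow>\<^sub>E {..R * n} :: ('a \<Rightarrow> nat) set) \<times> {..R * n}"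
    have fin: "finite (Basis \<rightarrow>\<^sub>E {..R * n} :: ('a \<Rightarrow> nat) set)" by (auto intro: finite_PiE)
    then have "finite I" by (simp add: I_def)
    have A_nonneg: "0 \<le> A \<alpha> b x" for \<alpha> b x by (simp add: A_def)
    have B_nonneg: "0 \<le> B \<alpha> k x" for \<alpha> k x by (simp add: B_def)
    have G_nonneg: "0 \<le> G i x" for i x
      unfolding G_def by (intro add_nonneg_nonneg sum_nonneg A_nonneg B_nonneg)
    have w_nonneg: "0 \<le> w i x" for i x
      unfolding w_def by (intro mult_nonneg_nonneg prod_nonneg) auto

    have F_poly: "F i \<in> poly_space (K * n)" for i
    proof -
      have "(\<lambda>x. poly (q (fst i b)) ((x \<bullet> b + real R1)\<^sup>2)) \<in> poly_space (K1 * n * (2 * 1))" for b :: 'a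
        by (intro poly_space_compose dq poly_space_power poly_space_add poly_space_inner poly_space_const) simp
      moreover have "(\<lambda>x. poly (q (snd i)) (\<phi> (t (fst i)) x)) \<in> poly_space (K1 * n * (2 * 1))"
        using chart[of "fst i"] by (intro poly_space_compose dq) simp
      ultimately have "F i \<in> poly_space (DIM('a) * (K1 * n * (2 * 1)) + K1 * n * (2 * 1))"
        unfolding F_def by (intro poly_space_mult poly_space_prod) auto
      then show ?thesis
        by (rule poly_space_mono) (simp add: K_def algebra_simps)
    qed

    have F_sum: "(\<Sum>i\<in>I. F i x) = 1" for x
    proof -
      have "(\<Sum>i\<in>I. F i x) = (\<Sum>\<alpha>\<in>Basis \<rightarrow>\<^sub>E {..R * n}. (\<Prod>b\<in>Basis. poly (q (\<alpha> b)) ((x \<bullet> b + real R1)\<^sup>2)) *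
          (\<Sum>k\<le>R * n. poly (q k) (\<phi> (t \<alpha>) x)))"
        unfolding I_def F_def by (simp add: sum.cartesian_product' sum_distrib_left)
      also have "\<dots> = (\<Sum>\<alpha>\<in>Basis \<rightarrow>\<^sub>E {..R * n}. (\<Prod>b\<in>Basis. poly (q (\<alpha> b)) ((x \<bullet> b + real R1)\<^sup>2)))"
        by (simp add: q_sum)
      also have "\<dots> = (\<Prod>b\<in>Basis. \<Sum>k\<le>R * n. poly (q k) ((x \<bullet> b + real R1)\<^sup>2))"
        by (subst prod_sum_PiE) auto
      finally show ?thesis by (simp add: q_sum)
    qed

    have w_sum: "(\<Sum>i\<in>I. w i x) \<le> 4 ^ (DIM('a) + 1)" for x
    proof -
      have "(\<Sum>i\<in>I. w i x) = (\<Sum>\<alpha>\<in>Basis \<rightarrow>\<^sub>E {..R * n}. (\<Prod>b\<in>Basis. 1 / (1 + A \<alpha> b x) ^ 2) *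
          (\<Sum>k\<le>R * n. 1 / (1 + B \<alpha> k x) ^ 2))"
        unfolding I_def w_def by (simp add: sum.cartesian_product' sum_distrib_left)
      also have "\<dots> \<le> (\<Sum>\<alpha>\<in>Basis \<rightarrow>\<^sub>E {..R * n}. (\<Prod>b\<in>Basis. 1 / (1 + A \<alpha> b x) ^ 2) * 4)"
        unfolding B_def by (intro sum_mono mult_left_mono sum_inverse_square_le prod_nonneg) auto
      also have "\<dots> = (\<Prod>b\<in>Basis. \<Sum>k\<le>R * n. 1 / (1 + \<bar>real n * (x \<bullet> b + real R1) - real k\<bar>) ^ 2) * 4"
        unfolding A_def by (subst prod_sum_PiE) (auto simp: sum_distrib_right)
      also have "\<dots> \<le> (\<Prod>b\<in>(Basis :: 'a set). 4) * 4"
        by (intro mult_right_mono prod_mono conjI sum_inverse_square_le sum_nonneg) auto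
      finally show ?thesis by simp
    qed

    have F_le: "\<bar>F i x\<bar> \<le> C1 ^ (DIM('a) + 1) * (1 + G i x) powr (- l) * w i x" if i: "i \<in> I" and x: "x \<in> \<Omega>" for i x
    proof -
      obtain \<alpha> k where ik: "i = (\<alpha>, k)" by fastforce
      have k: "k \<le> R * n" and \<alpha>: "\<And>b. b \<in> Basis \<Longrightarrow> \<alpha> b \<le> R * n"
        using i by (auto simp: ik I_def)
      have fac1: "\<bar>poly (q (\<alpha> b)) ((x \<bullet> b + real R1)\<^sup>2)\<bar> \<le> C1 * (1 / (1 + A \<alpha> b x) ^ (m + 2))" if b: "b \<in> Basis" for b
      proof -
        have "\<bar>x \<bullet> b\<bar> \<le> real R1" using Basis_le_norm[OF b, of x] R1[OF x] by linarith
        then have "0 \<le> x \<bullet> b + real R1" "x \<bullet> b + real R1 \<le> real R" by (auto simp: R_def)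
        then show ?thesis using q_le[OF \<alpha>[OF b]] by (simp add: A_def)
      qed
      have fac2: "\<bar>poly (q k) (\<phi> (t \<alpha>) x)\<bar> \<le> C1 * (1 / (1 + B \<alpha> k x) ^ (m + 2))"
      proof -
        have nn: "0 \<le> \<phi> (t \<alpha>) x" "\<phi> (t \<alpha>) x \<le> (real R0)\<^sup>2" using chart x by auto
        then have "sqrt (\<phi> (t \<alpha>) x) \<le> real R0" by (simp add: real_le_lsqrt)
        then have "sqrt (\<phi> (t \<alpha>) x) \<le> real R" by (simp add: R_def)
        then show ?thesis using q_le[OF k, of "sqrt (\<phi> (t \<alpha>) x)"] nn by (simp add: B_def)
      qed
      define Z where "Z = (\<Prod>b\<in>Basis. 1 + A \<alpha> b x) * (1 + B \<alpha> k x)"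
      have Z: "1 + G i x \<le> Z"
      proof -
        have "1 + G i x \<le> (1 + (\<Sum>b\<in>Basis. A \<alpha> b x)) * (1 + B \<alpha> k x)"
          using A_nonneg B_nonneg by (simp add: G_def ik algebra_simps sum_nonneg mult_nonneg_nonneg)
        also have "\<dots> \<le> Z"
          unfolding Z_def using A_nonneg B_nonneg
          by (intro mult_right_mono one_plus_sum_le_prod) (auto simp: add_nonneg_nonneg)
        finally show ?thesis .
      qed
      have "\<bar>F i x\<bar> = (\<Prod>b\<in>Basis. \<bar>poly (q (\<alpha> b)) ((x \<bullet> b + real R1)\<^sup>2)\<bar>) * \<bar>poly (q k) (\<phi> (t \<alpha>) x)\<bar>"
        by (simp add: F_def ik abs_mult abs_prod)
      also have "\<dots> \<le> (\<Prod>b\<in>Basis. C1 * (1 / (1 + A \<alpha> b x) ^ (m + 2))) * (C1 * (1 / (1 + B \<alpha> k x) ^ (m + 2)))"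
        using fac1 fac2 \<open>C1 > 0\<close> A_nonneg
        by (intro mult_mono prod_mono prod_nonneg conjI) (auto simp: add_nonneg_nonneg)
      also have "\<dots> = C1 ^ (DIM('a) + 1) * (1 / Z ^ m) * w i x"
        by (simp add: Z_def w_def ik prod.distrib prod_dividef prod_power_distrib power_add
            power_mult_distrib power2_eq_square mult_ac)
      also have "\<dots> \<le> C1 ^ (DIM('a) + 1) * (1 + G i x) powr (- l) * w i x"
      proof -
        have "1 / Z ^ m \<le> 1 / (1 + G i x) ^ m"
          using Z G_nonneg[of i x] by (intro divide_left_mono power_mono mult_pos_pos zero_less_power) auto
        also have "\<dots> = (1 + G i x) powr (- real m)"
          using G_nonneg[of i x] by (simp add: powr_minus_divide powr_realpow add_pos_nonneg)
        also have "\<dots> \<le> (1 + G i x) powr (- l)"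
          using G_nonneg[of i x] m by (intro powr_mono) auto
        finally show ?thesis
          using \<open>C1 > 0\<close> w_nonneg by (intro mult_right_mono mult_left_mono) auto
      qed
      finally show ?thesis .
    qed

    have rho_le: "real n * rho \<Omega> x z \<le> 2 * C0 * (G i x + G i z)" if x: "x \<in> \<Omega>" and z: "z \<in> \<Omega>" for i x z
    proof -
      obtain \<alpha> k where ik: "i = (\<alpha>, k)" by fastforce
      \<comment> \<open>Passing from the grid point to its closest point in \<open>\<Omega>\<close> costs a factor two.\<close>
      have near: "real n * norm (y - t \<alpha>) \<le> 2 * (\<Sum>b\<in>Basis. A \<alpha> b y)" if "y \<in> \<Omega>" for y
      proof -
        have "norm (y - t \<alpha>) \<le> 2 * norm (y - grid \<alpha>)"
          using closest_point_le[OF \<open>closed \<Omega>\<close> that, of "grid \<alpha>"] norm_triangle_ineq4[of "y - grid \<alpha>" "t \<alpha> - grid \<alpha>"]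
          by (simp add: dist_norm t_def norm_minus_commute)
        also have "\<dots> \<le> 2 * (\<Sum>b\<in>Basis. \<bar>(y - grid \<alpha>) \<bullet> b\<bar>)"
          by (intro mult_left_mono norm_le_l1) auto
        finally have "real n * norm (y - t \<alpha>) \<le> real n * (2 * (\<Sum>b\<in>Basis. \<bar>(y - grid \<alpha>) \<bullet> b\<bar>))"
          by (intro mult_left_mono) auto
        also have "\<dots> = 2 * (\<Sum>b\<in>Basis. \<bar>real n * ((y - grid \<alpha>) \<bullet> b)\<bar>)"
          by (simp add: sum_distrib_left abs_mult mult_ac)
        also have "(\<Sum>b\<in>Basis. \<bar>real n * ((y - grid \<alpha>) \<bullet> b)\<bar>) = (\<Sum>b\<in>Basis. A \<alpha> b y)"
        proof (rule sum.cong[OF refl])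
          fix b :: 'a assume "b \<in> Basis"
          then have "grid \<alpha> \<bullet> b = real (\<alpha> b) / real n - real R1"
            by (simp add: grid_def)
          then show "\<bar>real n * ((y - grid \<alpha>) \<bullet> b)\<bar> = A \<alpha> b y"
            using n by (simp add: A_def inner_diff_left right_diff_distrib distrib_left)
        qed
        finally show ?thesis .
      qed
      have "real n * \<bar>sqrt (\<phi> (t \<alpha>) x) - sqrt (\<phi> (t \<alpha>) z)\<bar> =
          \<bar>real n * sqrt (\<phi> (t \<alpha>) x) - real n * sqrt (\<phi> (t \<alpha>) z)\<bar>"
        by (simp add: abs_mult flip: right_diff_distrib)
      also have "\<dots> \<le> B \<alpha> k x + B \<alpha> k z" unfolding B_def by linarith
      finally have sq: "real n * \<bar>sqrt (\<phi> (t \<alpha>) x) - sqrt (\<phi> (t \<alpha>) z)\<bar> \<le> B \<alpha> k x + B \<alpha> k z" .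
      have "rho \<Omega> x z \<le> C0 * (norm (x - t \<alpha>) + norm (z - t \<alpha>) + \<bar>sqrt (\<phi> (t \<alpha>) x) - sqrt (\<phi> (t \<alpha>) z)\<bar>)"
        using chart x z by blast
      then have "real n * rho \<Omega> x z \<le> real n * (C0 * (norm (x - t \<alpha>) + norm (z - t \<alpha>) +
          \<bar>sqrt (\<phi> (t \<alpha>) x) - sqrt (\<phi> (t \<alpha>) z)\<bar>))"
        by (intro mult_left_mono) auto
      also have "\<dots> = C0 * (real n * norm (x - t \<alpha>) + real n * norm (z - t \<alpha>) +
          real n * \<bar>sqrt (\<phi> (t \<alpha>) x) - sqrt (\<phi> (t \<alpha>) z)\<bar>)"
        by (simp add: algebra_simps)
      also have "\<dots> \<le> C0 * (2 * (G i x + G i z))"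
        using near[OF x] near[OF z] sq B_nonneg[of \<alpha> k x] B_nonneg[of \<alpha> k z] \<open>C0 > 0\<close>
        by (intro mult_left_mono) (simp_all add: G_def ik)
      finally show ?thesis by (simp add: algebra_simps)
    qed

    have "\<exists>z\<in>\<Omega>. \<forall>x\<in>\<Omega>. G i z \<le> G i x" for i
    proof (rule continuous_attains_inf[OF \<Omega>])
      have "continuous_on \<Omega> (\<phi> (t (fst i)))"
        by (rule poly_space_continuous[OF conjunct1[OF chart]])
      then show "continuous_on \<Omega> (G i)"
        unfolding G_def A_def B_def by (intro continuous_intros)
    qed
    then obtain z where z: "\<And>i. z i \<in> \<Omega>" "\<And>i x. x \<in> \<Omega> \<Longrightarrow> G i (z i) \<le> G i x" by metis
    have "finite (z ` I)" "1 / real n > 0" using \<open>finite I\<close> n by auto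
    from maximal_separated_subset[where r = "rho \<Omega>", OF this rho_self rho_commute]
    obtain \<Lambda> where \<Lambda>: "\<Lambda> \<subseteq> z ` I" "separated (rho \<Omega>) (1 / real n) \<Lambda>"
      "\<forall>y\<in>z ` I. \<exists>\<xi>\<in>\<Lambda>. rho \<Omega> y \<xi> < 1 / real n"
      by blast
    then have "\<forall>i\<in>I. \<exists>\<xi>\<in>\<Lambda>. rho \<Omega> (z i) \<xi> < 1 / real n" by blast
    then obtain \<sigma> where \<sigma>: "\<And>i. i \<in> I \<Longrightarrow> \<sigma> i \<in> \<Lambda>" "\<And>i. i \<in> I \<Longrightarrow> rho \<Omega> (z i) (\<sigma> i) < 1 / real n"
      by metis
    have "finite \<Lambda>" using \<Lambda>(1) \<open>finite I\<close> finite_subset by blast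
    have "\<Lambda> \<subseteq> \<Omega>" using \<Lambda>(1) z(1) by blast

    have decay: "(1 + G i x) powr (- l) \<le> C5 powr l * (1 + real n * rho \<Omega> x (\<sigma> i)) powr (- l)"
      if i: "i \<in> I" and x: "x \<in> \<Omega>" for i x
    proof -
      have "real n * rho \<Omega> x (\<sigma> i) \<le> real n * rho \<Omega> x (z i) + real n * rho \<Omega> (z i) (\<sigma> i)"
        using rho_triangle[of \<Omega> x "\<sigma> i" "z i"] by (simp add: mult_left_mono flip: distrib_left)
      moreover have "real n * rho \<Omega> (z i) (\<sigma> i) \<le> 1"
        using \<sigma>(2)[OF i] n by (simp add: field_simps)
      moreover have "real n * rho \<Omega> x (z i) \<le> 4 * C0 * G i x"
      proof -
        have "real n * rho \<Omega> x (z i) \<le> 2 * C0 * (G i x + G i (z i))"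
          by (rule rho_le[OF x z(1)])
        also have "\<dots> \<le> 2 * C0 * (G i x + G i x)"
          using z(2)[OF x] \<open>C0 > 0\<close> by (intro mult_left_mono) auto
        finally show ?thesis by simp
      qed
      ultimately have "1 + real n * rho \<Omega> x (\<sigma> i) \<le> 2 + 4 * C0 * G i x" by linarith
      also have "\<dots> \<le> C5 * (1 + G i x)"
        using G_nonneg[of i x] \<open>C0 > 0\<close> by (simp add: C5_def algebra_simps)
      finally have le: "1 + real n * rho \<Omega> x (\<sigma> i) \<le> C5 * (1 + G i x)" .
      have pos: "1 + real n * rho \<Omega> x (\<sigma> i) > 0" "1 + G i x > 0"
        using rho_nonneg[of \<Omega> x "\<sigma> i"] G_nonneg[of i x] by (auto intro: add_pos_nonneg)
      have "(C5 * (1 + G i x)) powr (- l) \<le> (1 + real n * rho \<Omega> x (\<sigma> i)) powr (- l)"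
        using le pos l by (intro powr_mono2') auto
      then have "C5 powr l * (C5 * (1 + G i x)) powr (- l) \<le> C5 powr l * (1 + real n * rho \<Omega> x (\<sigma> i)) powr (- l)"
        by (intro mult_left_mono) auto
      moreover have "C5 powr l * (C5 * (1 + G i x)) powr (- l) = (1 + G i x) powr (- l)"
      proof -
        have "(C5 * (1 + G i x)) powr (- l) = C5 powr (- l) * (1 + G i x) powr (- l)"
          by (rule powr_mult)
        then show ?thesis
          using \<open>C5 > 0\<close> by (simp add: powr_minus)
      qed
      ultimately show ?thesis by simp
    qed

    define P where "P \<xi> x = (\<Sum>i\<in>{i \<in> I. \<sigma> i = \<xi>}. F i x)" for \<xi> x
    have "P \<xi> \<in> poly_space (K * n)" for \<xi>
      unfolding P_def by (intro poly_space_sum F_poly)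
    moreover have "(\<Sum>\<xi>\<in>\<Lambda>. P \<xi> x) = 1" for x
      unfolding P_def using \<sigma>(1) F_sum[of x] by (subst sum.group[OF \<open>finite I\<close> \<open>finite \<Lambda>\<close>]) auto
    moreover have "\<bar>P \<xi> x\<bar> \<le> C * (1 + real n * rho \<Omega> x \<xi>) powr (- l)" if x: "x \<in> \<Omega>" for \<xi> x
    proof -
      let ?D = "C1 ^ (DIM('a) + 1) * (C5 powr l * (1 + real n * rho \<Omega> x \<xi>) powr (- l))"
      have "?D \<ge> 0" using \<open>C1 > 0\<close> by simp
      have "\<bar>P \<xi> x\<bar> \<le> (\<Sum>i\<in>{i \<in> I. \<sigma> i = \<xi>}. \<bar>F i x\<bar>)"
        unfolding P_def by (rule sum_abs)
      also have "\<dots> \<le> (\<Sum>i\<in>{i \<in> I. \<sigma> i = \<xi>}. ?D * w i x)"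
      proof (rule sum_mono)
        fix i assume i: "i \<in> {i \<in> I. \<sigma> i = \<xi>}"
        have "\<bar>F i x\<bar> \<le> C1 ^ (DIM('a) + 1) * (1 + G i x) powr (- l) * w i x"
          using F_le[of i x] i x by simp
        also have "\<dots> \<le> ?D * w i x"
          using decay[of i x] i x \<open>C1 > 0\<close> w_nonneg[of i x]
          by (intro mult_right_mono mult_left_mono) auto
        finally show "\<bar>F i x\<bar> \<le> ?D * w i x" .
      qed
      also have "\<dots> \<le> (\<Sum>i\<in>I. ?D * w i x)"
        using \<open>?D \<ge> 0\<close> w_nonneg \<open>finite I\<close> by (intro sum_mono2) auto
      also have "\<dots> = ?D * (\<Sum>i\<in>I. w i x)" by (simp add: sum_distrib_left)
      also have "\<dots> \<le> ?D * 4 ^ (DIM('a) + 1)"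
        by (intro mult_left_mono w_sum \<open>?D \<ge> 0\<close>)
      finally show ?thesis by (simp add: C_def mult_ac)
    qed
    ultimately show ?thesis
      unfolding localized_partition_def using \<open>finite \<Lambda>\<close> \<open>\<Lambda> \<subseteq> \<Omega>\<close> \<Lambda>(2) by blast
  qed
  then show ?thesis using \<open>C > 0\<close> by blast
qed

text \<open>The factor \<open>K\<close> in the degree is absorbed by the constant: the partition for \<open>n div K\<close> has degree at most
\<open>n\<close>, its points are separated even further, and its decay is weaker by a constant factor only.  For
\<open>n < K\<close> the constant polynomial \<open>1\<close> attached to a single point suffices, since \<open>\<Omega>\<close> is bounded.\<close>

lemma localized_partition_degree_at_most:
  fixes \<Omega> :: "'a::euclidean_space set"
  assumes \<Omega>: "compact \<Omega>" "\<Omega> \<noteq> {}" and l: "l > 0" and "C > 0" and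
    part: "\<And>n. n \<ge> 1 \<Longrightarrow> localized_partition \<Omega> l C (K * n) n"
  shows "\<exists>C'>0. \<forall>n\<ge>1. localized_partition \<Omega> l C' n n"
proof -
  \<comment> \<open>A positive substitute for \<open>K\<close>, which may vanish.\<close>
  define k where "k = max K 1"
  have "k \<ge> 1" by (simp add: k_def)
  obtain \<xi>0 where \<xi>0: "\<xi>0 \<in> \<Omega>" using \<Omega> by blast
  have "\<exists>E>0. \<forall>x\<in>\<Omega>. rho \<Omega> x \<xi>0 \<le> E"
  proof -
    have "continuous_on \<Omega> (\<lambda>x. rho \<Omega> x \<xi>0)"
      unfolding rho_def by (intro continuous_intros)
    then obtain y where "\<forall>x\<in>\<Omega>. rho \<Omega> x \<xi>0 \<le> rho \<Omega> y \<xi>0"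
      using continuous_attains_sup[OF \<Omega>] by blast
    then show ?thesis
      by (intro exI[of _ "max 1 (rho \<Omega> y \<xi>0)"]) auto
  qed
  then obtain E where E: "E > 0" "\<And>x. x \<in> \<Omega> \<Longrightarrow> rho \<Omega> x \<xi>0 \<le> E" by blast
  define C' where "C' = C * (2 * real k) powr l + (1 + real k * E) powr l"
  have C': "C' > 0" "C * (2 * real k) powr l \<le> C'" "(1 + real k * E) powr l \<le> C'"
    using \<open>C > 0\<close> \<open>k \<ge> 1\<close> E by (auto simp: C'_def add_pos_pos intro!: add_pos_nonneg)
  have "localized_partition \<Omega> l C' n n" if n: "n \<ge> 1" for n
  proof (cases "n < k")
    case True
    have "1 \<le> C' * (1 + real n * rho \<Omega> x \<xi>0) powr (- l)" if x: "x \<in> \<Omega>" for x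
    proof -
      let ?y = "1 + real n * rho \<Omega> x \<xi>0"
      have "?y \<le> 1 + real k * E"
        using True E(2)[OF x] rho_nonneg[of \<Omega> x \<xi>0] by (intro add_left_mono mult_mono) auto
      moreover have "?y > 0" using rho_nonneg[of \<Omega> x \<xi>0] by (intro add_pos_nonneg) auto
      ultimately have "?y powr l \<le> (1 + real k * E) powr l"
        using l by (intro powr_mono2) auto
      then have "?y powr l \<le> C'" using C'(3) by linarith
      then show ?thesis using \<open>?y > 0\<close> by (simp add: powr_minus field_simps)
    qed
    then show ?thesis
      unfolding localized_partition_def using \<xi>0
      by (intro exI[of _ "{\<xi>0}"] exI[of _ "\<lambda>_ _. 1"]) (auto simp: separated_def intro: poly_space_const)
  next
    case False
    define n' where "n' = n div k"
    have n': "n' \<ge> 1" "k * n' \<le> n"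
      using False \<open>k \<ge> 1\<close> by (auto simp: n'_def div_greater_zero_iff Suc_le_eq)
    then have "K * n' \<le> n" unfolding k_def by (meson le_trans max.cobounded1 mult_le_mono1)
    have "n' \<le> n" using n'(2) \<open>k \<ge> 1\<close> by (metis le_trans mult_le_mono1 nat_mult_1)
    have "n < k * (n' + 1)"
      using \<open>k \<ge> 1\<close> by (simp add: n'_def dividend_less_times_div)
    also have "\<dots> \<le> k * (2 * n')" using n' by (intro mult_le_mono2) simp
    finally have "real n \<le> real (k * (2 * n'))" by (intro of_nat_mono) simp
    then have n_le: "real n \<le> 2 * real k * real n'" by simp
    obtain \<Lambda> P where \<Lambda>: "finite \<Lambda>" "\<Lambda> \<subseteq> \<Omega>" "separated (rho \<Omega>) (1 / real n') \<Lambda>"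
      and P: "\<And>\<xi>. \<xi> \<in> \<Lambda> \<Longrightarrow> P \<xi> \<in> poly_space (K * n')" "\<And>x. x \<in> \<Omega> \<Longrightarrow> (\<Sum>\<xi>\<in>\<Lambda>. P \<xi> x) = 1"
      "\<And>x \<xi>. x \<in> \<Omega> \<Longrightarrow> \<xi> \<in> \<Lambda> \<Longrightarrow> \<bar>P \<xi> x\<bar> \<le> C * (1 + real n' * rho \<Omega> x \<xi>) powr (- l)"
      using part[OF n'(1)] that by (rule localized_partitionE)
    have "1 / real n \<le> 1 / real n'"
      using \<open>n' \<le> n\<close> n' by (intro divide_left_mono) auto
    then have "separated (rho \<Omega>) (1 / real n) \<Lambda>"
      using \<Lambda>(3) unfolding separated_def by (meson order.trans)
    moreover have "P \<xi> \<in> poly_space n" if "\<xi> \<in> \<Lambda>" for \<xi>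
      by (rule poly_space_mono[OF P(1)[OF that] \<open>K * n' \<le> n\<close>])
    moreover have "\<bar>P \<xi> x\<bar> \<le> C' * (1 + real n * rho \<Omega> x \<xi>) powr (- l)" if "x \<in> \<Omega>" "\<xi> \<in> \<Lambda>" for x \<xi>
    proof -
      let ?u = "1 + real n' * rho \<Omega> x \<xi>" and ?v = "1 + real n * rho \<Omega> x \<xi>"
      have pos: "?u > 0" "?v > 0" using rho_nonneg[of \<Omega> x \<xi>] by (auto intro: add_pos_nonneg)
      have "?v \<le> 1 + 2 * real k * real n' * rho \<Omega> x \<xi>"
        using n_le rho_nonneg by (intro add_left_mono mult_right_mono)
      also have "\<dots> \<le> 2 * real k * ?u"
        using \<open>k \<ge> 1\<close> by (simp add: distrib_left)
      finally have "(2 * real k * ?u) powr (- l) \<le> ?v powr (- l)"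
        using pos l by (intro powr_mono2') auto
      moreover have "(2 * real k * ?u) powr (- l) = (2 * real k) powr (- l) * ?u powr (- l)"
        by (rule powr_mult)
      ultimately have "(2 * real k) powr l * ((2 * real k) powr (- l) * ?u powr (- l))
          \<le> (2 * real k) powr l * ?v powr (- l)"
        by (intro mult_left_mono) auto
      moreover have "(2 * real k) powr l * (2 * real k) powr (- l) = 1"
        using \<open>k \<ge> 1\<close> by (simp add: powr_minus)
      ultimately have "?u powr (- l) \<le> (2 * real k) powr l * ?v powr (- l)"
        by (simp flip: mult.assoc)
      then have "C * ?u powr (- l) \<le> C * ((2 * real k) powr l * ?v powr (- l))"
        using \<open>C > 0\<close> by (intro mult_left_mono) auto
      also have "\<dots> \<le> C' * ?v powr (- l)"
        unfolding mult.assoc[symmetric] using C' by (intro mult_right_mono) auto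
      finally show ?thesis using P(3)[OF that] by linarith
    qed
    ultimately show ?thesis
      unfolding localized_partition_def using \<Lambda>(1,2) P(2)
      by (intro exI[of _ \<Lambda>] exI[of _ P] conjI ballI) simp_all
  qed
  then show ?thesis using C' by blast
qed

theorem theorem1p12:
  fixes l :: real
  assumes "l > 1"
  shows "\<exists>c0::nat. c0 > 0 \<and>
    (\<forall>(D :: 'd::finite space set) \<Omega>. C2_domain D \<and> \<Omega> = closure D \<longrightarrow>
      (\<exists>C1::real. C1 > 0 \<and>
        (\<forall>n::nat. n > 0 \<longrightarrow>
          (\<exists>(m::nat) \<xi> P.
             inj_on \<xi> {1..m} \<and> \<xi> ` {1..m} \<subseteq> \<Omega> \<and>
             separated (rho \<Omega>) (1 / real n) (\<xi> ` {1..m}) \<and>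
             (\<forall>j\<in>{1..m}. P j \<in> poly_space (c0 * n)) \<and>
             (\<forall>x\<in>\<Omega>.
                (\<Sum>j=1..m. P j x) = 1 \<and>
                (\<forall>j\<in>{1..m}. \<bar>P j x\<bar> \<le> C1 * (1 + real n * rho \<Omega> x (\<xi> j)) powr (- l)))))))"
proof (rule exI[of _ 1], intro conjI allI impI)
  \<comment> \<open>Since \<open>C1\<close> may depend on the domain, degree \<open>n\<close> suffices.\<close>
  fix D \<Omega> :: "'d space set"
  assume "C2_domain D \<and> \<Omega> = closure D"
  then have D: "C2_domain D" and \<Omega>: "\<Omega> = closure D" by auto
  then have comp: "compact \<Omega>" "\<Omega> \<noteq> {}"
    by (auto simp: C2_domain_def)
  obtain r where r: "r > 0" "two_sided_ball r \<Omega>"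
    using C2_domain_two_sided_ball[OF D] \<Omega> by blast
  obtain R C0 where "C0 > 0" "\<forall>t\<in>\<Omega>. \<exists>\<phi>. quadratic_chart R C0 \<Omega> t \<phi>"
    using quadratic_chart_exists[OF comp r] by blast
  then obtain K C where KC: "C > 0" "\<And>n. n \<ge> 1 \<Longrightarrow> localized_partition \<Omega> l C (K * n) n"
    using localized_partition_exists[OF comp, of C0 R l] assms by auto
  have "l > 0" using assms by simp
  obtain C1 where C1: "C1 > 0" "\<And>n. n \<ge> 1 \<Longrightarrow> localized_partition \<Omega> l C1 n n"
    using localized_partition_degree_at_most[OF comp \<open>l > 0\<close> KC] by blast
  show "\<exists>C1::real. C1 > 0 \<and>
        (\<forall>n::nat. n > 0 \<longrightarrow>
          (\<exists>(m::nat) \<xi> P.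
             inj_on \<xi> {1..m} \<and> \<xi> ` {1..m} \<subseteq> \<Omega> \<and>
             separated (rho \<Omega>) (1 / real n) (\<xi> ` {1..m}) \<and>
             (\<forall>j\<in>{1..m}. P j \<in> poly_space (1 * n)) \<and>
             (\<forall>x\<in>\<Omega>.
                (\<Sum>j=1..m. P j x) = 1 \<and>
                (\<forall>j\<in>{1..m}. \<bar>P j x\<bar> \<le> C1 * (1 + real n * rho \<Omega> x (\<xi> j)) powr (- l)))))"
  proof (intro exI[of _ C1] conjI allI impI C1(1))
    fix n :: nat assume "n > 0"
    then have "localized_partition \<Omega> l C1 n n" by (intro C1(2)) simp
    then obtain \<Lambda> P where \<Lambda>: "finite \<Lambda>" "\<Lambda> \<subseteq> \<Omega>" "separated (rho \<Omega>) (1 / real n) \<Lambda>"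
      and P: "\<And>\<xi>. \<xi> \<in> \<Lambda> \<Longrightarrow> P \<xi> \<in> poly_space n" "\<And>x. x \<in> \<Omega> \<Longrightarrow> (\<Sum>\<xi>\<in>\<Lambda>. P \<xi> x) = 1"
      "\<And>x \<xi>. x \<in> \<Omega> \<Longrightarrow> \<xi> \<in> \<Lambda> \<Longrightarrow> \<bar>P \<xi> x\<bar> \<le> C1 * (1 + real n * rho \<Omega> x \<xi>) powr (- l)"
      using that by (rule localized_partitionE)
    obtain \<xi> where \<xi>: "bij_betw \<xi> {1..card \<Lambda>} \<Lambda>"
      using ex_bij_betw_nat_finite_1[OF \<Lambda>(1)] by blast
    then have img: "\<xi> ` {1..card \<Lambda>} = \<Lambda>" and inj: "inj_on \<xi> {1..card \<Lambda>}"
      by (auto simp: bij_betw_def)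
    have mem: "\<xi> j \<in> \<Lambda>" if "j \<in> {1..card \<Lambda>}" for j using img that by blast
    have "(\<Sum>j=1..card \<Lambda>. P (\<xi> j) x) = (\<Sum>\<xi>\<in>\<Lambda>. P \<xi> x)" for x
      by (rule sum.reindex_bij_betw[OF \<xi>])
    then show "\<exists>(m::nat) \<xi> P. inj_on \<xi> {1..m} \<and> \<xi> ` {1..m} \<subseteq> \<Omega> \<and>
             separated (rho \<Omega>) (1 / real n) (\<xi> ` {1..m}) \<and>
             (\<forall>j\<in>{1..m}. P j \<in> poly_space (1 * n)) \<and>
             (\<forall>x\<in>\<Omega>.
                (\<Sum>j=1..m. P j x) = 1 \<and>
                (\<forall>j\<in>{1..m}. \<bar>P j x\<bar> \<le> C1 * (1 + real n * rho \<Omega> x (\<xi> j)) powr (- l)))"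
      using inj img \<Lambda> P mem
      by (intro exI[of _ "card \<Lambda>"] exI[of _ \<xi>] exI[of _ "\<lambda>j. P (\<xi> j)"]) simp
  qed
qed simp

end
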